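(* Let target rates $\mathcal I^0_l>0$ be given, let $M_l=\mathrm{Rank}(H_{l,l})$ and $\gamma^0_l=e^{\mathcal I^0_l/M_l}-1$, and consider $$\textbf{SPMP}:\ \min_{\Sigma_{1:L}}\sum_{l=1}^L\mathrm{Tr}(\Sigma_l)\ \text{ s.t. } \mathcal I_l(\Sigma_{1:L},\Phi)\ge\mathcal I^0_l,\ \Sigma_l\succeq0,\ l=1,\dots,L,$$ $$\textbf{ESPMP}:\ \min_{\{T,R,p\}}\|p\|_1\ \text{ s.t. } \gamma_{l,m}\ge\gamma^0_l,\ 1\le m\le M_l,\ 1\le l\le L.$$ If $\{\tilde T,\tilde R,\tilde p\}$ is an optimum of ESPMP, then the input covariance matrices $\tilde\Sigma_l=\sum_m\tilde p_{l,m}\tilde t_{l,m}\tilde t_{l,m}^\dagger$ form an optimum of SPMP. Conversely, if $\tilde\Sigma_{1:L}$ is an optimum of SPMP, then there exists a decomposition of it leading to a strategy $\{\tilde T,\tilde R,\tilde p\}$ that is an optimum of ESPMP.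
   Context: A MIMO B-MAC network has $L$ data links. Link $l$ has transmitter $T_l$ with $L_{T_l}$ antennas and receiver $R_l$ with $L_{R_l}$ antennas; $H_{l,k}\in\mathbb C^{L_{R_l}\times L_{T_k}}$ is the channel matrix from $T_k$ to $R_l$. The input of link $k$ is circularly symmetric complex Gaussian with covariance $\Sigma_k\succeq0$, and the noise at each receiver is circularly symmetric complex Gaussian with identity covariance. A coupling matrix $\Phi\in\{0,1\}^{L\times L}$ with $\Phi_{l,l}=0$ specifies whether the signal of link $k$ still interferes with link $l$ after interference cancellation ($\Phi_{l,k}=1$) or is completely cancelled ($\Phi_{l,k}=0$); $\Phi$ is assumed valid, i.e. realizable by a scheme in which each signal is decoded by at most one receiver. For $\Sigma_{1:L}$ let $\Omega_l=I+\sum_{k=1}^L\Phi_{l,k}H_{l,k}\Sigma_kH_{l,k}^\dagger$ and $\mathcal I_l(\Sigma_{1:L},\Phi)=\log\left|I+H_{l,l}\Sigma_lH_{l,l}^\dagger\Omega_l^{-1}\right|$. The problems are assumed feasible. Streams: with $M_l$ streams for link $l$, a strategy $\{T,R,p\}$ consists of unit-norm transmit vectors $t_{l,m}\in\mathbb C^{L_{T_l}}$ (collected in $T$), powers $p_{l,m}\ge0$ (collected in $p$), and unit-norm receive vectors $r_{l,m}$ (collected in $R$); it corresponds to input covariances $\Sigma_l=\sum_m p_{l,m}t_{l,m}t_{l,m}^\dagger$ (a "decomposition" of $\Sigma_{1:L}$). Streams of link $l$ are decoded in order $m=1,\dots,M_l$ with cancellation. Cross-talk coefficients: $\Psi^{k,n}_{l,m}=0$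 if $k=l,m\ge n$; $=|r_{l,m}^\dagger H_{l,l}t_{l,n}|^2$ if $k=l,m<n$; $=\Phi_{l,k}|r_{l,m}^\dagger H_{l,k}t_{k,n}|^2$ otherwise. SINR: $\gamma_{l,m}=\dfrac{p_{l,m}|r_{l,m}^\dagger H_{l,l}t_{l,m}|^2}{1+\sum_{k}\sum_{n=1}^{M_k}p_{k,n}\Psi^{k,n}_{l,m}}$. *)

theory Defs
  imports "Jordan_Normal_Form.Schur_Decomposition" "Jordan_Normal_Form.DL_Rank"
begin

(* Links are indexed 0..<L, streams of link l are indexed 0..<M l (decoding order = index order).
   NT l = L_{T_l} (transmit antennas), NR l = L_{R_l} (receive antennas).
   H l k = H_{l,k} : channel from T_k to R_l, a (NR l) x (NT k) complex matrix.
   Phi l k = True  iff  Phi_{l,k} = 1. *)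

definition cinner :: "complex vec \<Rightarrow> complex vec \<Rightarrow> complex" where
  "cinner r v = (\<Sum>i<dim_vec r. cnj (r $ i) * v $ i)"

definition cvnorm :: "complex vec \<Rightarrow> real" where
  "cvnorm v = sqrt (\<Sum>i<dim_vec v. (cmod (v $ i))\<^sup>2)"

definition mtrace :: "complex mat \<Rightarrow> complex" where
  "mtrace A = (\<Sum>i<dim_row A. A $$ (i, i))"

definition psd_mat :: "nat \<Rightarrow> complex mat \<Rightarrow> bool" where
  "psd_mat n A \<longleftrightarrow> A \<in> carrier_mat n n \<and> mat_adjoint A = A \<and>
     (\<forall>v \<in> carrier_vec n. 0 \<le> Re (cinner v (A *\<^sub>v v)))"

definition Omega :: "nat \<Rightarrow> (nat \<Rightarrow> nat) \<Rightarrow> (nat \<Rightarrow> nat \<Rightarrow> complex mat) \<Rightarrow>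
    (nat \<Rightarrow> nat \<Rightarrow> bool) \<Rightarrow> (nat \<Rightarrow> complex mat) \<Rightarrow> nat \<Rightarrow> complex mat" where
  "Omega L NR H Phi S l =
     mat (NR l) (NR l) (\<lambda>(i, j). (if i = j then 1 else 0) +
       (\<Sum>k<L. if Phi l k then (H l k * S k * mat_adjoint (H l k)) $$ (i, j) else 0))"

definition rate :: "nat \<Rightarrow> (nat \<Rightarrow> nat) \<Rightarrow> (nat \<Rightarrow> nat \<Rightarrow> complex mat) \<Rightarrow>
    (nat \<Rightarrow> nat \<Rightarrow> bool) \<Rightarrow> (nat \<Rightarrow> complex mat) \<Rightarrow> nat \<Rightarrow> real" where
  "rate L NR H Phi S l =
     ln (cmod (det (1\<^sub>m (NR l) + H l l * S l * mat_adjoint (H l l)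
                     * the (mat_inverse (Omega L NR H Phi S l)))))"

definition SPMP_feasible where
  "SPMP_feasible L NT NR H Phi I0 S \<longleftrightarrow>
     (\<forall>l<L. psd_mat (NT l) (S l) \<and> rate L NR H Phi S l \<ge> I0 l)"

definition SPMP_obj :: "nat \<Rightarrow> (nat \<Rightarrow> complex mat) \<Rightarrow> real" where
  "SPMP_obj L S = (\<Sum>l<L. Re (mtrace (S l)))"

definition SPMP_optimal where
  "SPMP_optimal L NT NR H Phi I0 S \<longleftrightarrow>
     SPMP_feasible L NT NR H Phi I0 S \<and>
     (\<forall>S'. SPMP_feasible L NT NR H Phi I0 S' \<longrightarrow> SPMP_obj L S \<le> SPMP_obj L S')"

definition nstreams :: "(nat \<Rightarrow> nat) \<Rightarrow> (nat \<Rightarrow> nat \<Rightarrow> complex mat) \<Rightarrow> nat \<Rightarrow> nat" where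
  "nstreams NR H l = vec_space.rank (NR l) (H l l :: complex mat)"

definition gamma0 :: "(nat \<Rightarrow> nat) \<Rightarrow> (nat \<Rightarrow> nat \<Rightarrow> complex mat) \<Rightarrow> (nat \<Rightarrow> real) \<Rightarrow> nat \<Rightarrow> real" where
  "gamma0 NR H I0 l = exp (I0 l / real (nstreams NR H l)) - 1"

definition valid_strategy where
  "valid_strategy L NT NR M T R (p :: nat \<Rightarrow> nat \<Rightarrow> real) \<longleftrightarrow>
     (\<forall>l<L. \<forall>m<M l. T l m \<in> carrier_vec (NT l) \<and> cvnorm (T l m) = 1 \<and>
                    R l m \<in> carrier_vec (NR l) \<and> cvnorm (R l m) = 1 \<and> 0 \<le> p l m)"

definition Psi where
  "Psi H Phi T R l m k n =
     (if k = l then (if m \<ge> n then 0 else (cmod (cinner (R l m) (H l l *\<^sub>v T l n)))\<^sup>2)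
      else (if Phi l k then (cmod (cinner (R l m) (H l k *\<^sub>v T k n)))\<^sup>2 else 0))"

definition SINR where
  "SINR L M H Phi T R p l m =
     p l m * (cmod (cinner (R l m) (H l l *\<^sub>v T l m)))\<^sup>2 /
     (1 + (\<Sum>k<L. \<Sum>n<M k. p k n * Psi H Phi T R l m k n))"

definition ESPMP_feasible where
  "ESPMP_feasible L NT NR H Phi I0 T R p \<longleftrightarrow>
     valid_strategy L NT NR (nstreams NR H) T R p \<and>
     (\<forall>l<L. \<forall>m<nstreams NR H l.
        SINR L (nstreams NR H) H Phi T R p l m \<ge> gamma0 NR H I0 l)"

definition ESPMP_obj where
  "ESPMP_obj L M (p :: nat \<Rightarrow> nat \<Rightarrow> real) = (\<Sum>l<L. \<Sum>m<M l. \<bar>p l m\<bar>)"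

definition ESPMP_optimal where
  "ESPMP_optimal L NT NR H Phi I0 T R p \<longleftrightarrow>
     ESPMP_feasible L NT NR H Phi I0 T R p \<and>
     (\<forall>T' R' p'. ESPMP_feasible L NT NR H Phi I0 T' R' p' \<longrightarrow>
        ESPMP_obj L (nstreams NR H) p \<le> ESPMP_obj L (nstreams NR H) p')"

definition cov_of where
  "cov_of NT M T (p :: nat \<Rightarrow> nat \<Rightarrow> real) l =
     mat (NT l) (NT l) (\<lambda>(i, j). \<Sum>m<M l. complex_of_real (p l m) * T l m $ i * cnj (T l m $ j))"

end

theory Submission
  imports Defs
begin

text \<open>
  For a positive definite noise covariance \<open>C\<close>, the ratio \<open>det (C + \<Sum> g g\<^sup>\<dagger>) / det C\<close> is the product
  of the factors \<open>1 + g\<^sup>\<dagger> D\<^sup>-\<^sup>1 g\<close>, where \<open>D\<close> is \<open>C\<close> plus the streams decoded later. By Cauchy-Schwarz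
  \<open>g\<^sup>\<dagger> D\<^sup>-\<^sup>1 g\<close> is the largest SINR that any receiver can reach, so a feasible strategy has feasible
  covariances with the same total power.

  Conversely, write a feasible covariance as a Gram matrix. Unitary mixing of its vectors leaves it
  unchanged. Mixing first pushes all but \<open>rank H\<close> of the vectors into the kernel of \<open>H\<close>; dropping these
  saves power and harms no link. Mixing the remaining ones makes all factors equal to their geometric
  mean \<open>\<mu>\<close>: the form \<open>|u|\<^sup>2 + g(u)\<^sup>\<dagger> C\<^sup>-\<^sup>1 g(u)\<close> on unit combinations \<open>u\<close> takes the value \<open>\<mu>\<close> by the
  intermediate value theorem; decode such a combination last, add it to the noise, and recurse.
  At an optimum no power can be saved, so nothing was dropped and the covariance is preserved exactly.
\<close>

section \<open>Positive definite forms\<close>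

text \<open>\<open>ESPMP\<close> asks the same SINR of all streams of a link, with the target chosen
  so that \<open>(1 + gamma0)^M = exp I0\<close>. The factors belonging to an arbitrary
  factorization of a covariance are unequal, and there may be more vectors than the
  \<open>M = rank H\<close> streams allowed; hence the mixing. It has to keep the covariance itself,
  which also fixes the power spent and the interference at all other links. The product of the
  factors is a ratio of determinants, so mixing preserves it. The mean \<mu> therefore stays the
  right target after each split: a stream decoded last contributes exactly \<mu> and leaves
  \<open>\<mu>^(N-1)\<close> to the others. The value \<mu> is attained because a form above \<mu>
  on all combinations would push every factor above \<mu>, and a form below \<mu> would push every
  factor below it. Semidefinite matrices are factored by Cholesky elimination into lists of vectors,
  so no spectral theory enters.\<close>

lemma mat_adjoint_dim [simp]:
  "dim_row (mat_adjoint A) = dim_col A" "dim_col (mat_adjoint A) = dim_row A"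
  by (simp_all add: mat_adjoint_def)

lemma mat_adjoint_carrier [simp]:
  "A \<in> carrier_mat m n \<Longrightarrow> mat_adjoint A \<in> carrier_mat n m"
  by (auto intro: carrier_matI)

lemma mat_adjoint_index [simp]:
  fixes A :: "complex mat"
  assumes "i < dim_col A" "j < dim_row A"
  shows "mat_adjoint A $$ (i, j) = cnj (A $$ (j, i))"
  using assms by (simp add: mat_adjoint_def mat_of_rows_def)

lemma mat_adjoint_add:
  fixes A B :: "complex mat"
  assumes "A \<in> carrier_mat m n" "B \<in> carrier_mat m n"
  shows "mat_adjoint (A + B) = mat_adjoint A + mat_adjoint B"
  using assms by (intro eq_matI) auto

lemma mult_mat_vec_index:
  assumes "A \<in> carrier_mat m n" "x \<in> carrier_vec n" "i < m"
  shows "(A *\<^sub>v x) $ i = (\<Sum>j<n. A $$ (i, j) * x $ j)"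
  using assms by (simp add: scalar_prod_def lessThan_atLeast0)

lemma cinner_add_right:
  assumes "y \<in> carrier_vec n" "z \<in> carrier_vec n" "x \<in> carrier_vec n"
  shows "cinner x (y + z) = cinner x y + cinner x z"
  using assms by (simp add: cinner_def sum.distrib distrib_left)

lemma cinner_add_left:
  assumes "y \<in> carrier_vec n" "z \<in> carrier_vec n"
  shows "cinner (y + z) x = cinner y x + cinner z x"
  using assms by (simp add: cinner_def sum.distrib distrib_right)

lemma cinner_smult_right:
  assumes "y \<in> carrier_vec n" "x \<in> carrier_vec n"
  shows "cinner x (c \<cdot>\<^sub>v y) = c * cinner x y"
  using assms by (simp add: cinner_def sum_distrib_left mult_ac)

lemma cinner_smult_left: "cinner (c \<cdot>\<^sub>v y) x = cnj c * cinner y x"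
  by (simp add: cinner_def sum_distrib_left mult_ac)

lemma cinner_commute:
  assumes "y \<in> carrier_vec n" "x \<in> carrier_vec n"
  shows "cinner x y = cnj (cinner y x)"
  using assms by (simp add: cinner_def mult_ac)

lemma cinner_self:
  "cinner x x = complex_of_real (\<Sum>i<dim_vec x. (cmod (x $ i))\<^sup>2)"
  unfolding cinner_def of_real_sum complex_norm_square by (simp add: mult.commute)

lemma cinner_self_Re_nonneg: "0 \<le> Re (cinner x x)"
  by (simp add: cinner_self sum_nonneg)

lemma cinner_self_eq_0:
  assumes "x \<in> carrier_vec n" "Re (cinner x x) = 0"
  shows "x = 0\<^sub>v n"
proof -
  have "(\<Sum>i<n. (cmod (x $ i))\<^sup>2) = 0"
    using assms by (simp add: cinner_self)
  then have "\<forall>i<n. x $ i = 0"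
    by (subst (asm) sum_nonneg_eq_0_iff) auto
  then show ?thesis using assms by (intro eq_vecI) auto
qed

lemma cvnorm_sq: "(cvnorm x)\<^sup>2 = Re (cinner x x)"
  by (simp add: cvnorm_def cinner_self sum_nonneg)

lemma cvnorm_eq_1_iff: "cvnorm x = 1 \<longleftrightarrow> Re (cinner x x) = 1"
  by (simp add: cvnorm_def cinner_self)

lemma cinner_adjoint:
  assumes "A \<in> carrier_mat m n" "x \<in> carrier_vec m" "y \<in> carrier_vec n"
  shows "cinner x (A *\<^sub>v y) = cinner (mat_adjoint A *\<^sub>v x) y"
proof -
  have "cinner x (A *\<^sub>v y) = (\<Sum>i<m. \<Sum>j<n. cnj (x $ i) * (A $$ (i, j) * y $ j))"
    using assms by (simp add: cinner_def mult_mat_vec_index[of _ m n] sum_distrib_left del: index_mult_mat_vec)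
  also have "\<dots> = (\<Sum>j<n. \<Sum>i<m. cnj (x $ i) * (A $$ (i, j) * y $ j))"
    by (rule sum.swap)
  also have "\<dots> = (\<Sum>j<n. cnj ((mat_adjoint A *\<^sub>v x) $ j) * y $ j)"
  proof (rule sum.cong)
    fix j assume "j \<in> {..<n}"
    then have "(mat_adjoint A *\<^sub>v x) $ j = (\<Sum>i<m. cnj (A $$ (i, j)) * x $ i)"
      using assms by (simp add: mult_mat_vec_index[of _ n m] del: index_mult_mat_vec)
    then show "(\<Sum>i<m. cnj (x $ i) * (A $$ (i, j) * y $ j)) = cnj ((mat_adjoint A *\<^sub>v x) $ j) * y $ j"
      by (simp only: cnj_sum) (simp add: sum_distrib_right sum_distrib_left mult_ac)
  qed simp
  finally show ?thesis using assms by (simp add: cinner_def)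
qed

definition qform :: "complex mat \<Rightarrow> complex vec \<Rightarrow> real" where
  "qform C x = Re (cinner x (C *\<^sub>v x))"

definition hermitian_mat :: "nat \<Rightarrow> complex mat \<Rightarrow> bool" where
  "hermitian_mat n C \<longleftrightarrow> C \<in> carrier_mat n n \<and> mat_adjoint C = C"

definition pd_mat :: "nat \<Rightarrow> complex mat \<Rightarrow> bool" where
  "pd_mat n C \<longleftrightarrow> hermitian_mat n C \<and> (\<forall>v\<in>carrier_vec n. v \<noteq> 0\<^sub>v n \<longrightarrow> 0 < qform C v)"

lemma psd_mat_iff:
  "psd_mat n C \<longleftrightarrow> hermitian_mat n C \<and> (\<forall>v\<in>carrier_vec n. 0 \<le> qform C v)"
  by (auto simp: psd_mat_def hermitian_mat_def qform_def)

lemma pd_imp_psd: "pd_mat n C \<Longrightarrow> psd_mat n C"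
proof -
  assume C: "pd_mat n C"
  have "0 \<le> qform C v" if "v \<in> carrier_vec n" for v
  proof (cases "v = 0\<^sub>v n")
    case True
    then show ?thesis by (simp add: qform_def cinner_def)
  next
    case False
    then show ?thesis using C that by (auto simp: pd_mat_def less_imp_le)
  qed
  then show ?thesis using C by (simp add: psd_mat_iff pd_mat_def)
qed

lemma pd_mat_carrier: "pd_mat n C \<Longrightarrow> C \<in> carrier_mat n n"
  by (simp add: pd_mat_def hermitian_mat_def)

lemma hermitian_cinner:
  assumes "hermitian_mat n C" "x \<in> carrier_vec n" "y \<in> carrier_vec n"
  shows "cinner x (C *\<^sub>v y) = cinner (C *\<^sub>v x) y"
  using assms cinner_adjoint[of C n n x y] by (simp add: hermitian_mat_def)

lemma hermitian_cinner_cnj: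
  assumes "hermitian_mat n C" "x \<in> carrier_vec n" "y \<in> carrier_vec n"
  shows "cinner x (C *\<^sub>v y) = cnj (cinner y (C *\<^sub>v x))"
proof -
  have "C *\<^sub>v x \<in> carrier_vec n" using assms by (auto simp: hermitian_mat_def)
  then show ?thesis
    using hermitian_cinner[OF assms] cinner_commute[of y n "C *\<^sub>v x"] assms by simp
qed

lemma hermitian_cinner_self:
  assumes "hermitian_mat n C" "x \<in> carrier_vec n"
  shows "cinner x (C *\<^sub>v x) = complex_of_real (qform C x)"
  using hermitian_cinner_cnj[OF assms(1) assms(2) assms(2)]
  by (simp add: qform_def complex_eq_iff)

lemma qform_combination:
  assumes C: "hermitian_mat n C" and x: "x \<in> carrier_vec n" and y: "y \<in> carrier_vec n"
  shows "qform C (a \<cdot>\<^sub>v x + b \<cdot>\<^sub>v y) =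
    (cmod a)\<^sup>2 * qform C x + 2 * Re (cnj a * b * cinner x (C *\<^sub>v y)) + (cmod b)\<^sup>2 * qform C y"
proof -
  have cc: "C \<in> carrier_mat n n" using C by (simp add: hermitian_mat_def)
  then have cx: "C *\<^sub>v x \<in> carrier_vec n" and cy: "C *\<^sub>v y \<in> carrier_vec n" using x y by auto
  have "C *\<^sub>v (a \<cdot>\<^sub>v x + b \<cdot>\<^sub>v y) = a \<cdot>\<^sub>v (C *\<^sub>v x) + b \<cdot>\<^sub>v (C *\<^sub>v y)"
    using cc x y by (simp add: mult_add_distrib_mat_vec[of _ n n] mult_mat_vec[of _ n n])
  then have "cinner (a \<cdot>\<^sub>v x + b \<cdot>\<^sub>v y) (C *\<^sub>v (a \<cdot>\<^sub>v x + b \<cdot>\<^sub>v y)) =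
     cnj a * a * cinner x (C *\<^sub>v x) + cnj a * b * cinner x (C *\<^sub>v y)
      + (cnj b * a * cinner y (C *\<^sub>v x) + cnj b * b * cinner y (C *\<^sub>v y))"
    using x y cx cy
    by (simp add: cinner_add_left[of _ n] cinner_add_right[of _ n] cinner_smult_left
       cinner_smult_right[of _ n] algebra_simps)
  also have "cinner y (C *\<^sub>v x) = cnj (cinner x (C *\<^sub>v y))"
    by (rule hermitian_cinner_cnj[OF C y x])
  also have "cnj a * a = of_real ((cmod a)\<^sup>2)"
    by (simp add: complex_norm_square mult.commute del: of_real_power)
  also have "cnj b * b = of_real ((cmod b)\<^sup>2)"
    by (simp add: complex_norm_square mult.commute del: of_real_power)
  finally have eq: "cinner (a \<cdot>\<^sub>v x + b \<cdot>\<^sub>v y) (C *\<^sub>v (a \<cdot>\<^sub>v x + b \<cdot>\<^sub>v y)) =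
     of_real ((cmod a)\<^sup>2) * cinner x (C *\<^sub>v x) + cnj a * b * cinner x (C *\<^sub>v y)
      + (cnj b * a * cnj (cinner x (C *\<^sub>v y)) + of_real ((cmod b)\<^sup>2) * cinner y (C *\<^sub>v y))" .
  have "Re (cnj b * a * cnj (cinner x (C *\<^sub>v y))) = Re (cnj a * b * cinner x (C *\<^sub>v y))"
    by (simp add: algebra_simps)
  then show ?thesis
    unfolding qform_def eq by (simp del: of_real_power)
qed

text \<open>Positivity at \<open>x - s * cnj c * y\<close> with real \<open>s\<close>, where
  \<open>cnj c\<close> cancels the phase of the mixed term, gives a real quadratic in
  \<open>s\<close>. Null vectors of the form are allowed: the zero pivot in the Cholesky step relies
  on them.\<close>

lemma psd_Cauchy_Schwarz:
  assumes C: "psd_mat n C" and x: "x \<in> carrier_vec n" and y: "y \<in> carrier_vec n"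
  shows "(cmod (cinner x (C *\<^sub>v y)))\<^sup>2 \<le> qform C x * qform C y"
proof -
  define c where "c = cinner x (C *\<^sub>v y)"
  have herm: "hermitian_mat n C" and nn: "\<And>v. v \<in> carrier_vec n \<Longrightarrow> 0 \<le> qform C v"
    using C by (auto simp: psd_mat_iff)
  have key: "0 \<le> qform C x - 2 * s * (cmod c)\<^sup>2 + s\<^sup>2 * (cmod c)\<^sup>2 * qform C y" for s :: real
  proof -
    have "0 \<le> qform C (1 \<cdot>\<^sub>v x + (- of_real s * cnj c) \<cdot>\<^sub>v y)"
      using x y by (intro nn) auto
    also have "\<dots> = qform C x - 2 * s * (cmod c)\<^sup>2 + s\<^sup>2 * (cmod c)\<^sup>2 * qform C y"
    proof -
      have "cnj 1 * (- of_real s * cnj c) * c = of_real (- s) * (c * cnj c)"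
        by simp
      also have "\<dots> = of_real (- s * (cmod c)\<^sup>2)"
        unfolding complex_norm_square[symmetric] by simp
      finally have "Re (cnj 1 * (- of_real s * cnj c) * c) = - s * (cmod c)\<^sup>2"
        by (metis Re_complex_of_real)
      note e = qform_combination[OF herm x y, of 1 "- of_real s * cnj c", folded c_def, unfolded this]
      show ?thesis unfolding e by (simp add: norm_mult power_mult_distrib)
    qed
    finally show ?thesis .
  qed
  show ?thesis
  proof (cases "qform C y = 0")
    case True
    have "(cmod c)\<^sup>2 = 0"
    proof (rule ccontr)
      assume c0: "(cmod c)\<^sup>2 \<noteq> 0"
      \<comment> \<open>Without a quadratic term, any \<open>s\<close> whose linear term exceeds
        \<open>qform C x\<close> gives the contradiction; here the excess is 1.\<close>
      define s where "s = (qform C x + 1) / (2 * (cmod c)\<^sup>2)"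
      have "2 * s * (cmod c)\<^sup>2 = qform C x + 1"
        using c0 by (simp add: s_def)
      moreover have "0 \<le> qform C x - 2 * s * (cmod c)\<^sup>2"
        using key[of s] True by simp
      ultimately show False by linarith
    qed
    then show ?thesis using True by (simp add: c_def)
  next
    case False
    then have pos: "0 < qform C y" using nn[OF y] by simp
    \<comment> \<open>The value \<open>s = 1 / qform C y\<close> minimizes the quadratic.\<close>
    have "0 \<le> qform C x - 2 * (1 / qform C y) * (cmod c)\<^sup>2 + (1 / qform C y)\<^sup>2 * (cmod c)\<^sup>2 * qform C y"
      by (rule key)
    also have "\<dots> = qform C x - (cmod c)\<^sup>2 / qform C y"
      using pos by (simp add: power2_eq_square field_simps)
    finally show ?thesis using pos by (simp add: c_def field_simps)
  qed
qed

section \<open>Inverse covariances and the best SINR\<close>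

definition minv :: "complex mat \<Rightarrow> complex mat" where
  "minv C = the (mat_inverse C)"

lemma pd_det_nonzero:
  assumes "pd_mat n C"
  shows "det C \<noteq> 0"
proof
  assume "det C = 0"
  then obtain v where v: "v \<in> carrier_vec n" "v \<noteq> 0\<^sub>v n" "C *\<^sub>v v = 0\<^sub>v n"
    using det_0_iff_vec_prod_zero[OF pd_mat_carrier[OF assms]] by auto
  then have "qform C v = 0" by (simp add: qform_def cinner_def)
  then show False using assms v by (auto simp: pd_mat_def)
qed

lemma pd_minv:
  assumes "pd_mat n C"
  shows "minv C \<in> carrier_mat n n" "C * minv C = 1\<^sub>m n" "minv C * C = 1\<^sub>m n"
proof -
  have C: "C \<in> carrier_mat n n" using assms by (rule pd_mat_carrier)
  have "C \<in> Units (ring_mat TYPE(complex) n n)"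
    by (rule det_non_zero_imp_unit[OF C pd_det_nonzero[OF assms]])
  then obtain B where "mat_inverse C = Some B"
    using mat_inverse(1)[OF C, of n] by (cases "mat_inverse C") auto
  then show "minv C \<in> carrier_mat n n" "C * minv C = 1\<^sub>m n" "minv C * C = 1\<^sub>m n"
    using mat_inverse(2)[OF C] by (auto simp: minv_def)
qed

text \<open>For a stream \<open>g\<close> in noise of covariance \<open>C\<close> this is the
  largest SINR over all receivers: an upper bound by \<open>cinner_sq_le_qform_iform\<close>,
  attained by \<open>mmse_receiver\<close>.\<close>

definition iform :: "complex mat \<Rightarrow> complex vec \<Rightarrow> real" where
  "iform C g = qform (minv C) g"

lemma pd_minv_vec:
  assumes "pd_mat n C" "g \<in> carrier_vec n"
  shows "minv C *\<^sub>v g \<in> carrier_vec n" "C *\<^sub>v (minv C *\<^sub>v g) = g"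
proof -
  show "minv C *\<^sub>v g \<in> carrier_vec n" using pd_minv(1)[OF assms(1)] assms(2) by simp
  have "C *\<^sub>v (minv C *\<^sub>v g) = (C * minv C) *\<^sub>v g"
    using pd_minv(1)[OF assms(1)] pd_mat_carrier[OF assms(1)] assms(2)
    by (simp add: assoc_mult_mat_vec[of _ n n _ n])
  then show "C *\<^sub>v (minv C *\<^sub>v g) = g" using pd_minv(2)[OF assms(1)] assms(2) by simp
qed

text \<open>Self-adjointness of \<open>C\<close> at the preimages of \<open>x\<close> and
  \<open>y\<close> is self-adjointness of the inverse at \<open>x\<close> and \<open>y\<close>; unit
  vectors then read off the entries.\<close>

lemma pd_minv_hermitian:
  assumes C: "pd_mat n C"
  shows "hermitian_mat n (minv C)"
proof -
  let ?B = "minv C"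
  note B = pd_minv[OF C] and cc = pd_mat_carrier[OF C]
  have herm: "hermitian_mat n C" using C by (simp add: pd_mat_def)
  have adj: "cinner x (?B *\<^sub>v y) = cinner (?B *\<^sub>v x) y"
    if x: "x \<in> carrier_vec n" and y: "y \<in> carrier_vec n" for x y
    using hermitian_cinner[OF herm pd_minv_vec(1)[OF C x] pd_minv_vec(1)[OF C y]]
    by (simp add: pd_minv_vec(2)[OF C x] pd_minv_vec(2)[OF C y])
  have "mat_adjoint ?B = ?B"
  proof (rule eq_matI)
    fix i j assume "i < dim_row ?B" "j < dim_col ?B"
    then have i: "i < n" and j: "j < n" using B(1) by auto
    have 1: "cinner (unit_vec n i) (?B *\<^sub>v unit_vec n j) = ?B $$ (i, j)"
      using i j B(1)
      by (simp add: cinner_def scalar_prod_def unit_vec_def if_distrib[of cnj]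
          if_distrib[of "\<lambda>x. x * _"] if_distrib[of "\<lambda>x. _ * x"] sum.If_cases cong: if_cong)
    have 2: "cinner (?B *\<^sub>v unit_vec n i) (unit_vec n j) = cnj (?B $$ (j, i))"
      using i j B(1)
      by (simp add: cinner_def scalar_prod_def unit_vec_def if_distrib[of cnj]
          if_distrib[of "\<lambda>x. x * _"] if_distrib[of "\<lambda>x. _ * x"] sum.If_cases cong: if_cong)
    show "mat_adjoint ?B $$ (i, j) = ?B $$ (i, j)"
      using adj[of "unit_vec n i" "unit_vec n j"] 1 2 i j B(1) by simp
  qed (use B(1) in auto)
  then show ?thesis using B(1) by (simp add: hermitian_mat_def)
qed

lemma iform_eq:
  assumes "pd_mat n C" "g \<in> carrier_vec n"
  shows "qform C (minv C *\<^sub>v g) = iform C g" "cinner g (minv C *\<^sub>v g) = of_real (iform C g)"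
    "cinner (minv C *\<^sub>v g) g = of_real (iform C g)"
proof -
  have h: "hermitian_mat n (minv C)" by (rule pd_minv_hermitian[OF assms(1)])
  show 2: "cinner g (minv C *\<^sub>v g) = of_real (iform C g)"
    unfolding iform_def by (rule hermitian_cinner_self[OF h assms(2)])
  show 3: "cinner (minv C *\<^sub>v g) g = of_real (iform C g)"
    using hermitian_cinner[OF h assms(2) assms(2)] 2 by simp
  show "qform C (minv C *\<^sub>v g) = iform C g"
    using 3 pd_minv_vec[OF assms] by (simp add: qform_def)
qed

lemma iform_pos:
  assumes "pd_mat n C" "g \<in> carrier_vec n" "g \<noteq> 0\<^sub>v n"
  shows "0 < iform C g"
proof -
  have "C *\<^sub>v 0\<^sub>v n = 0\<^sub>v n"
    using pd_mat_carrier[OF assms(1)] by (intro eq_vecI) (auto simp: scalar_prod_def)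
  then have "minv C *\<^sub>v g \<noteq> 0\<^sub>v n"
    using pd_minv_vec[OF assms(1,2)] assms(3) by auto
  then show ?thesis
    using iform_eq(1)[OF assms(1,2)] assms(1) pd_minv_vec(1)[OF assms(1,2)]
    by (auto simp: pd_mat_def)
qed

lemma iform_nonneg:
  assumes "pd_mat n C" "g \<in> carrier_vec n"
  shows "0 \<le> iform C g"
  using iform_eq(1)[OF assms] pd_imp_psd[OF assms(1)] pd_minv_vec(1)[OF assms]
  by (metis psd_mat_iff)

text \<open>Cauchy-Schwarz in the form of \<open>C\<close> between \<open>r\<close> and
  \<open>C^-1 g\<close>, because \<open>C\<close> maps the latter to \<open>g\<close>. Divided by
  \<open>qform C r\<close>, the noise power after the receiver \<open>r\<close>, this bounds the
  SINR.\<close>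

lemma cinner_sq_le_qform_iform:
  assumes "pd_mat n C" "r \<in> carrier_vec n" "g \<in> carrier_vec n"
  shows "(cmod (cinner r g))\<^sup>2 \<le> qform C r * iform C g"
  using psd_Cauchy_Schwarz[OF pd_imp_psd[OF assms(1)] assms(2) pd_minv_vec(1)[OF assms(1,3)]]
  by (simp add: pd_minv_vec(2)[OF assms(1,3)] iform_eq(1)[OF assms(1,3)])

section \<open>Gram matrices and determinants\<close>

text \<open>A list rather than a matrix factor: mixing acts on single members, and
  \<open>gain\<close> reads the decoding order from the list.\<close>

definition gram :: "nat \<Rightarrow> complex vec list \<Rightarrow> complex mat" where
  "gram n xs = mat n n (\<lambda>(i, j). \<Sum>x\<leftarrow>xs. x $ i * cnj (x $ j))"

lemma gram_carrier [simp]: "gram n xs \<in> carrier_mat n n"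
  by (simp add: gram_def)

lemma gram_dim [simp]: "dim_row (gram n xs) = n" "dim_col (gram n xs) = n"
  by (simp_all add: gram_def)

lemma gram_Nil [simp]: "gram n [] = 0\<^sub>m n n"
  by (auto simp: gram_def)

lemma gram_append: "gram n (xs @ ys) = gram n xs + gram n ys"
  by (auto simp: gram_def)

lemma gram_Cons: "gram n (x # xs) = gram n [x] + gram n xs"
  using gram_append[of n "[x]" xs] by simp

lemma hermitian_gram: "hermitian_mat n (gram n xs)"
proof -
  have "cnj (\<Sum>x\<leftarrow>xs. f x) = (\<Sum>x\<leftarrow>xs. cnj (f x))" for f :: "complex vec \<Rightarrow> complex"
    by (induction xs) auto
  then show ?thesis
    by (auto simp: hermitian_mat_def mult.commute gram_def intro!: eq_matI)
qed

lemma hermitian_add: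
  "hermitian_mat n A \<Longrightarrow> hermitian_mat n B \<Longrightarrow> hermitian_mat n (A + B)"
  by (auto simp: hermitian_mat_def mat_adjoint_add)

lemma qform_add:
  assumes "A \<in> carrier_mat n n" "B \<in> carrier_mat n n" "v \<in> carrier_vec n"
  shows "qform (A + B) v = qform A v + qform B v"
  using assms
  by (simp add: qform_def add_mult_distrib_mat_vec[of _ n n] cinner_add_right[of _ n])

lemma gram_single_mult_vec:
  assumes "x \<in> carrier_vec n" "v \<in> carrier_vec n"
  shows "gram n [x] *\<^sub>v v = cinner x v \<cdot>\<^sub>v x"
proof (rule eq_vecI)
  fix i assume "i < dim_vec (cinner x v \<cdot>\<^sub>v x)"
  then have i: "i < n" using assms by simp
  have "(gram n [x] *\<^sub>v v) $ i = (\<Sum>j<n. (x $ i * cnj (x $ j)) * v $ j)"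
    using i assms by (simp add: mult_mat_vec_index[of _ n n] gram_def del: index_mult_mat_vec)
  then show "(gram n [x] *\<^sub>v v) $ i = (cinner x v \<cdot>\<^sub>v x) $ i"
    using i assms by (simp add: cinner_def sum_distrib_left sum_distrib_right mult_ac)
qed (use assms in auto)

lemma qform_gram_single:
  assumes "x \<in> carrier_vec n" "v \<in> carrier_vec n"
  shows "qform (gram n [x]) v = (cmod (cinner v x))\<^sup>2"
proof -
  have "cinner v (gram n [x] *\<^sub>v v) = cinner v x * cnj (cinner v x)"
    using assms
    by (simp add: gram_single_mult_vec cinner_smult_right[of _ n] cinner_commute[of v n x, symmetric])
  also have "\<dots> = of_real ((cmod (cinner v x))\<^sup>2)"
    by (simp add: complex_norm_square del: of_real_power)
  finally show ?thesis by (simp add: qform_def del: of_real_power)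
qed

lemma qform_zero_mat: "v \<in> carrier_vec n \<Longrightarrow> qform (0\<^sub>m n n) v = 0"
proof -
  assume v: "v \<in> carrier_vec n"
  then have "0\<^sub>m n n *\<^sub>v v = 0\<^sub>v n" by (intro eq_vecI) (auto simp: scalar_prod_def)
  then show ?thesis using v by (simp add: qform_def cinner_def)
qed

lemma qform_gram:
  assumes "set xs \<subseteq> carrier_vec n" "v \<in> carrier_vec n"
  shows "qform (gram n xs) v = (\<Sum>x\<leftarrow>xs. (cmod (cinner v x))\<^sup>2)"
  using assms(1)
proof (induction xs)
  case (Cons x xs)
  then show ?case
    using assms(2) by (simp add: gram_Cons[of n x xs] qform_add[of _ n] qform_gram_single)
qed (use assms in \<open>simp add: qform_zero_mat\<close>)

lemma qform_gram_nonneg: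
  assumes "set xs \<subseteq> carrier_vec n" "v \<in> carrier_vec n"
  shows "0 \<le> qform (gram n xs) v"
  unfolding qform_gram[OF assms] by (intro sum_list_nonneg) auto

lemma pd_add_gram:
  assumes C: "pd_mat n C" and xs: "set xs \<subseteq> carrier_vec n"
  shows "pd_mat n (C + gram n xs)"
  using C pd_mat_carrier[OF C] qform_gram_nonneg[OF xs]
  by (auto simp: pd_mat_def hermitian_add hermitian_gram qform_add[of _ n] intro: add_pos_nonneg)

text \<open>A channel acts on the list member by member, so a mixing that preserves the transmit
  covariance preserves the received one as well.\<close>

lemma gram_map_mult:
  assumes H: "H \<in> carrier_mat m n" and xs: "set xs \<subseteq> carrier_vec n"
  shows "H * gram n xs * mat_adjoint H = gram m (map ((*\<^sub>v) H) xs)"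
  using xs
proof (induction xs)
  case Nil
  then show ?case using H by auto
next
  case (Cons x xs)
  have "H * gram n [x] * mat_adjoint H = gram m [H *\<^sub>v x]"
  proof (rule eq_matI)
    fix i j assume "i < dim_row (gram m [H *\<^sub>v x])" "j < dim_col (gram m [H *\<^sub>v x])"
    then have ij: "i < m" "j < m" by auto
    have "(H * gram n [x] * mat_adjoint H) $$ (i, j) =
       (\<Sum>b<n. (\<Sum>a<n. H $$ (i, a) * (x $ a * cnj (x $ b))) * cnj (H $$ (j, b)))"
      using ij H by (simp add: scalar_prod_def gram_def lessThan_atLeast0)
    also have "\<dots> = (\<Sum>a<n. H $$ (i, a) * x $ a) * cnj (\<Sum>b<n. H $$ (j, b) * x $ b)"
      by (simp add: sum_distrib_left sum_distrib_right mult_ac)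
    also have "\<dots> = (H *\<^sub>v x) $ i * cnj ((H *\<^sub>v x) $ j)"
      using ij H Cons.prems by (simp add: mult_mat_vec_index[of _ m n] del: index_mult_mat_vec)
    finally show "(H * gram n [x] * mat_adjoint H) $$ (i, j) = gram m [H *\<^sub>v x] $$ (i, j)"
      using ij by (simp add: gram_def)
  qed (use H in auto)
  moreover have "H * gram n (x # xs) * mat_adjoint H
      = H * gram n [x] * mat_adjoint H + H * gram n xs * mat_adjoint H"
    unfolding gram_Cons[of n x xs]
    using H by (simp add: mult_add_distrib_mat[of _ m n _ n] add_mult_distrib_mat[of _ m n _ _ m])
  ultimately show ?case
    using Cons by (simp add: gram_Cons[of m "H *\<^sub>v x" "map ((*\<^sub>v) H) xs"])
qed

text \<open>The matrix determinant lemma, by eliminating the bordered matrix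
  \<open>X = [[C, g], [-g^H, 1]]\<close> in two ways. Column operations \<open>Y\<close> clear the
  lower left block and leave \<open>C + g g^H\<close> above it; row operations \<open>Z\<close>
  clear the same block and leave the Schur complement \<open>1 + g^H C^-1 g\<close> beside
  it.\<close>

lemma det_rank_one_update:
  assumes C: "pd_mat n C" and g: "g \<in> carrier_vec n"
  shows "det (C + gram n [g]) = det C * of_real (1 + iform C g)"
proof -
  have cc: "C \<in> carrier_mat n n" by (rule pd_mat_carrier[OF C])
  note B = pd_minv[OF C]
  define G where "G = mat n 1 (\<lambda>(i, _). g $ i)"
  define G' where "G' = mat 1 n (\<lambda>(_, j). - cnj (g $ j))"
  define X where "X = four_block_mat C G G' (1\<^sub>m 1)"
  have Gc: "G \<in> carrier_mat n 1" "G' \<in> carrier_mat 1 n" by (auto simp: G_def G'_def)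
  have X: "X \<in> carrier_mat (n + 1) (n + 1)"
    unfolding X_def by (rule four_block_carrier_mat[OF cc]) simp
  define Y where "Y = four_block_mat (1\<^sub>m n) (0\<^sub>m n 1) (- G') (1\<^sub>m 1)"
  define Z where "Z = four_block_mat (1\<^sub>m n) (0\<^sub>m n 1) (- G' * minv C) (1\<^sub>m 1)"
  have YZ: "Y \<in> carrier_mat (n + 1) (n + 1)" "Z \<in> carrier_mat (n + 1) (n + 1)"
    using B Gc by (auto simp: Y_def Z_def)
  have dY: "det Y = 1" unfolding Y_def
    by (subst det_four_block_mat_upper_right_zero[of _ n _ 1]) (use Gc in auto)
  have dZ: "det Z = 1" unfolding Z_def
    by (subst det_four_block_mat_upper_right_zero[of _ n _ 1]) (use Gc B in auto)
  have s1: "C + G * (- G') = C + gram n [g]"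
    using cc Gc by (auto simp: gram_def G_def G'_def scalar_prod_def)
  have s2: "G' + - G' = 0\<^sub>m 1 n" using Gc by auto
  have "X * Y = four_block_mat (C + gram n [g]) G (0\<^sub>m 1 n) (1\<^sub>m 1)"
    unfolding X_def Y_def
    by (subst mult_four_block_mat[of _ n n _ 1 _ 1 _ _ n _ 1])
       (use cc Gc s1 s2 in auto)
  then have "det X * det Y = det (C + gram n [g])"
    using det_mult[OF X YZ(1)] det_four_block_mat_lower_left_zero[of "C + gram n [g]" n G 1 "0\<^sub>m 1 n" "1\<^sub>m 1"] Gc cc
    by simp
  then have 1: "det X = det (C + gram n [g])" using dY by simp
  have Gm: "- G' * minv C \<in> carrier_mat 1 n" using Gc B by auto
  have "- G' * minv C * C = - G'"
    using Gc B cc by (simp add: assoc_mult_mat[of _ 1 n _ n _ n])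
  then have s3: "- G' * minv C * C + G' = 0\<^sub>m 1 n"
    using Gc by (auto)
  have "(- G' * minv C * G + 1\<^sub>m 1) = mat 1 1 (\<lambda>_. of_real (1 + iform C g))"
  proof (rule eq_matI)
    fix i j assume "i < dim_row (mat 1 1 (\<lambda>_. complex_of_real (1 + iform C g)))"
      "j < dim_col (mat 1 1 (\<lambda>_. complex_of_real (1 + iform C g)))"
    then have ij: "i = 0" "j = 0" by auto
    have "- G' * minv C * G = - G' * (minv C * G)"
      using Gc B by (simp add: assoc_mult_mat[of _ 1 n _ n _ 1])
    moreover have "(- G' * (minv C * G)) $$ (0, 0) = (\<Sum>i<n. cnj (g $ i) * (\<Sum>j<n. minv C $$ (i, j) * g $ j))"
      using Gc B by (simp add: scalar_prod_def G_def G'_def lessThan_atLeast0 sum_negf)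
    moreover have "\<dots> = cinner g (minv C *\<^sub>v g)"
      using B g by (simp add: cinner_def scalar_prod_def lessThan_atLeast0)
    ultimately show "(- G' * minv C * G + 1\<^sub>m 1) $$ (i, j) = mat 1 1 (\<lambda>_. complex_of_real (1 + iform C g)) $$ (i, j)"
      using ij iform_eq(2)[OF C g] Gc B by simp
  qed (use Gc B in auto)
  then have s4: "(- G' * minv C) * G + 1\<^sub>m 1 * 1\<^sub>m 1 = mat 1 1 (\<lambda>_. of_real (1 + iform C g))" by simp
  have "Z * X = four_block_mat C G (0\<^sub>m 1 n) (mat 1 1 (\<lambda>_. of_real (1 + iform C g)))"
    unfolding X_def Z_def
    by (subst mult_four_block_mat[of _ n n _ 1 _ 1 _ _ n _ 1])
       (use cc Gc Gm s3 s4 in auto)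
  then have "det Z * det X = det C * of_real (1 + iform C g)"
    using det_mult[OF YZ(2) X]
      det_four_block_mat_lower_left_zero[of "C" n G 1 "0\<^sub>m 1 n" "mat 1 1 (\<lambda>_. of_real (1 + iform C g))"] Gc cc
    by (simp add: det_single)
  then show ?thesis using 1 dZ by simp
qed

text \<open>The head is decoded first and faces the whole tail as interference; the last member
  faces only \<open>C\<close>.\<close>

primrec gain :: "nat \<Rightarrow> complex mat \<Rightarrow> complex vec list \<Rightarrow> real" where
  "gain n C [] = 1"
| "gain n C (g # gs) = (1 + iform (C + gram n gs) g) * gain n C gs"

lemma det_add_gram:
  assumes C: "pd_mat n C" and gs: "set gs \<subseteq> carrier_vec n"
  shows "det (C + gram n gs) = det C * of_real (gain n C gs)"
  using gs
proof (induction gs)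
  case Nil
  then show ?case using pd_mat_carrier[OF C] by simp
next
  case (Cons g gs)
  have "C + gram n (g # gs) = (C + gram n gs) + gram n [g]"
    using pd_mat_carrier[OF C] unfolding gram_Cons[of n g gs]
    by (intro eq_matI) auto
  moreover have "det \<dots> = det (C + gram n gs) * of_real (1 + iform (C + gram n gs) g)"
    using det_rank_one_update[OF pd_add_gram[OF C, of gs]] Cons.prems by auto
  ultimately show ?case using Cons by simp
qed

lemma gain_pos:
  assumes C: "pd_mat n C" and gs: "set gs \<subseteq> carrier_vec n"
  shows "0 < gain n C gs"
  using gs
proof (induction gs)
  case (Cons g gs)
  then show ?case using iform_nonneg[OF pd_add_gram[OF C, of gs], of g] by simp
qed simp

text \<open>The single factors depend on the list, but their product is a ratio of determinants and
  sees only the Gram matrix.\<close>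

lemma gain_cong_gram:
  assumes C: "pd_mat n C" and "set gs \<subseteq> carrier_vec n" "set gs' \<subseteq> carrier_vec n"
    and "gram n gs = gram n gs'"
  shows "gain n C gs = gain n C gs'"
  using det_add_gram[OF C assms(2)] det_add_gram[OF C assms(3)] assms(4) pd_det_nonzero[OF C]
  by simp

lemma gain_append:
  assumes "C \<in> carrier_mat n n"
  shows "gain n C (xs @ ys) = gain n (C + gram n ys) xs * gain n C ys"
proof (induction xs)
  case (Cons x xs)
  have "C + gram n (xs @ ys) = C + gram n ys + gram n xs"
    using assms unfolding gram_append by (intro eq_matI) auto
  then show ?case using Cons by simp
qed simp

text \<open>Connects \<open>gain\<close> with the expression in \<open>rate\<close>. The determinant
  is a positive real, so \<open>cmod\<close> only undoes the embedding into the complex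
  numbers.\<close>

lemma ln_cmod_det_eq_ln_gain:
  assumes C: "pd_mat n C" and gs: "set gs \<subseteq> carrier_vec n"
  shows "ln (cmod (det (1\<^sub>m n + gram n gs * minv C))) = ln (gain n C gs)"
proof -
  note B = pd_minv[OF C] and cc = pd_mat_carrier[OF C]
  have "(C + gram n gs) * minv C = 1\<^sub>m n + gram n gs * minv C"
    using B cc by (simp add: add_mult_distrib_mat[of _ n n])
  then have "det (1\<^sub>m n + gram n gs * minv C) = det (C + gram n gs) * det (minv C)"
    using det_mult[of "C + gram n gs" n "minv C"] B cc by simp
  moreover have "det C * det (minv C) = 1"
    using det_mult[OF cc B(1)] B by simp
  ultimately have "det (1\<^sub>m n + gram n gs * minv C) = of_real (gain n C gs)"
    unfolding det_add_gram[OF C gs] by (simp add: mult_ac)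
  then show ?thesis using gain_pos[OF C gs] by simp
qed

section \<open>Unit combinations of vectors\<close>

text \<open>Coefficients are functions on all of \<open>nat\<close>, so that removing the head of
  the list is a shift; values past the length do not matter.\<close>

definition lin_comb :: "nat \<Rightarrow> (nat \<Rightarrow> complex) \<Rightarrow> complex vec list \<Rightarrow> complex vec" where
  "lin_comb n u xs = vec n (\<lambda>i. \<Sum>j<length xs. u j * (xs ! j) $ i)"

lemma lin_comb_carrier [simp]: "lin_comb n u xs \<in> carrier_vec n"
  by (simp add: lin_comb_def)

lemma lin_comb_Nil [simp]: "lin_comb n u [] = 0\<^sub>v n"
  by (auto simp: lin_comb_def)

lemma lin_comb_Cons:
  assumes "x \<in> carrier_vec n"
  shows "lin_comb n u (x # xs) = u 0 \<cdot>\<^sub>v x + lin_comb n (\<lambda>j. u (Suc j)) xs"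
  using assms by (intro eq_vecI) (auto simp: lin_comb_def sum.lessThan_Suc_shift simp del: sum.lessThan_Suc)

lemma lin_comb_cong:
  assumes "\<And>j. j < length xs \<Longrightarrow> u j = v j"
  shows "lin_comb n u xs = lin_comb n v xs"
  using assms by (auto simp: lin_comb_def)

lemma lin_comb_zero:
  assumes "\<And>j. j < length xs \<Longrightarrow> u j = 0"
  shows "lin_comb n u xs = 0\<^sub>v n"
  using assms by (intro eq_vecI) (auto simp: lin_comb_def)

lemma lin_comb_smult: "lin_comb n (\<lambda>j. c * u j) xs = c \<cdot>\<^sub>v lin_comb n u xs"
  by (intro eq_vecI) (auto simp: lin_comb_def sum_distrib_left mult_ac)

lemma lin_comb_add: "lin_comb n (\<lambda>j. u j + v j) xs = lin_comb n u xs + lin_comb n v xs"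
  by (intro eq_vecI) (auto simp: lin_comb_def sum.distrib distrib_right)

lemma mult_lin_comb:
  assumes H: "H \<in> carrier_mat m n" and xs: "set xs \<subseteq> carrier_vec n"
  shows "H *\<^sub>v lin_comb n u xs = lin_comb m u (map ((*\<^sub>v) H) xs)"
  using xs
proof (induction xs arbitrary: u)
  case Nil
  then show ?case using H by (intro eq_vecI) (auto simp: scalar_prod_def)
next
  case (Cons x xs)
  then show ?case
    using H by (simp add: lin_comb_Cons[of _ n] lin_comb_Cons[of _ m] mult_add_distrib_mat_vec[of _ m n] mult_mat_vec[of _ m n])
qed

definition sqnorm :: "(nat \<Rightarrow> complex) \<Rightarrow> nat \<Rightarrow> real" where
  "sqnorm u m = (\<Sum>j<m. (cmod (u j))\<^sup>2)"

lemma sqnorm_Suc: "sqnorm u (Suc m) = (cmod (u 0))\<^sup>2 + sqnorm (\<lambda>j. u (Suc j)) m"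
  by (simp add: sqnorm_def sum.lessThan_Suc_shift del: sum.lessThan_Suc)

lemma sqnorm_nonneg: "0 \<le> sqnorm u m"
  by (simp add: sqnorm_def sum_nonneg)

lemma sqnorm_eq_0_iff: "sqnorm u m = 0 \<longleftrightarrow> (\<forall>j<m. u j = 0)"
  unfolding sqnorm_def by (subst sum_nonneg_eq_0_iff) auto

lemma sqnorm_smult: "sqnorm (\<lambda>j. c * u j) m = (cmod c)\<^sup>2 * sqnorm u m"
  by (simp add: sqnorm_def norm_mult power_mult_distrib sum_distrib_left)

text \<open>Plane rotations change a family of vectors without changing its Gram matrix, and they can
  turn any unit combination of the family into its last member.\<close>

lemma gram_rotation:
  assumes x: "x \<in> carrier_vec n" and y: "y \<in> carrier_vec n"
    and ab: "(cmod a)\<^sup>2 + (cmod b)\<^sup>2 = 1"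
  shows "gram n [(- cnj b) \<cdot>\<^sub>v x + cnj a \<cdot>\<^sub>v y, a \<cdot>\<^sub>v x + b \<cdot>\<^sub>v y] = gram n [x, y]"
proof (rule eq_matI)
  fix i j assume "i < dim_row (gram n [x, y])" "j < dim_col (gram n [x, y])"
  then have ij: "i < n" "j < n" by auto
  have "a * cnj a + b * cnj b = 1"
    using ab unfolding complex_norm_square[symmetric] by (metis of_real_1 of_real_add)
  then have "(a * cnj a + b * cnj b) * (x $ i * cnj (x $ j)) + (a * cnj a + b * cnj b) * (y $ i * cnj (y $ j))
     = x $ i * cnj (x $ j) + y $ i * cnj (y $ j)" by simp
  then show "gram n [(- cnj b) \<cdot>\<^sub>v x + cnj a \<cdot>\<^sub>v y, a \<cdot>\<^sub>v x + b \<cdot>\<^sub>v y] $$ (i, j) = gram n [x, y] $$ (i, j)"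
    using ij x y by (simp add: gram_def algebra_simps)
qed auto

lemma gram_combination:
  assumes "set xs \<subseteq> carrier_vec n" "sqnorm u (length xs) = 1"
  shows "\<exists>ys. Suc (length ys) = length xs \<and> set ys \<subseteq> carrier_vec n \<and>
    gram n (ys @ [lin_comb n u xs]) = gram n xs"
  using assms
proof (induction xs arbitrary: u)
  case Nil
  then show ?case by (simp add: sqnorm_def)
next
  case (Cons x xs)
  define v where "v = (\<lambda>j. u (Suc j))"
  define s where "s = sqrt (sqnorm v (length xs))"
  have x: "x \<in> carrier_vec n" and xs: "set xs \<subseteq> carrier_vec n" using Cons.prems by auto
  have one: "(cmod (u 0))\<^sup>2 + s\<^sup>2 = 1"
    using Cons.prems(2) by (simp add: s_def v_def sqnorm_Suc sqnorm_nonneg)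
  have lc: "lin_comb n u (x # xs) = u 0 \<cdot>\<^sub>v x + lin_comb n v xs"
    using x by (simp add: lin_comb_Cons v_def)
  show ?case
  proof (cases "s = 0")
    \<comment> \<open>All weight lies on \<open>x\<close>: the combination is \<open>x\<close> times
      a phase, and moving it to the end changes no Gram sum.\<close>
    case True
    then have "\<forall>j<length xs. v j = 0"
      by (simp add: s_def sqnorm_eq_0_iff)
    then have l: "lin_comb n u (x # xs) = u 0 \<cdot>\<^sub>v x"
      using x lc by (simp add: lin_comb_zero)
    have "u 0 * cnj (u 0) = 1"
      using one True unfolding complex_norm_square[symmetric] by simp
    then have "gram n [u 0 \<cdot>\<^sub>v x] = gram n [x]"
      using x by (auto simp: gram_def intro!: eq_matI)
    then have "gram n (xs @ [lin_comb n u (x # xs)]) = gram n (x # xs)"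
      unfolding l gram_append gram_Cons[of n x xs]
      by (simp add: comm_add_mat[of _ n n])
    then show ?thesis using xs by (intro exI[of _ xs]) simp
  next
    case False
    \<comment> \<open>The tail coefficients, scaled to norm 1, yield by induction a last member
      \<open>?h\<close>. Rotating \<open>x\<close> against \<open>?h\<close> with weights
      \<open>u 0\<close> and \<open>s\<close> then produces the full combination.\<close>
    define w where "w = (\<lambda>j. of_real (1 / s) * v j)"
    have vs: "sqnorm v (length xs) = s\<^sup>2" by (simp add: s_def sqnorm_nonneg)
    have "sqnorm w (length xs) = (cmod (of_real (1 / s)))\<^sup>2 * sqnorm v (length xs)"
      unfolding w_def by (rule sqnorm_smult)
    also have "\<dots> = 1"
      using False unfolding vs by (simp only: norm_of_real power2_abs) (simp add: power_divide)
    finally obtain ys where ys: "Suc (length ys) = length xs" "set ys \<subseteq> carrier_vec n"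
      "gram n (ys @ [lin_comb n w xs]) = gram n xs"
      using Cons.IH[OF xs] by blast
    let ?h = "lin_comb n w xs"
    have "of_real s \<cdot>\<^sub>v ?h = lin_comb n v xs"
      unfolding lin_comb_smult[symmetric] by (rule lin_comb_cong) (use False in \<open>simp add: w_def\<close>)
    then have l: "lin_comb n u (x # xs) = u 0 \<cdot>\<^sub>v x + of_real s \<cdot>\<^sub>v ?h" using lc by simp
    define z where "z = (- cnj (of_real s)) \<cdot>\<^sub>v x + cnj (u 0) \<cdot>\<^sub>v ?h"
    have z: "z \<in> carrier_vec n" using x by (simp add: z_def)
    have rot: "gram n [z, lin_comb n u (x # xs)] = gram n [x, ?h]"
      unfolding l z_def by (rule gram_rotation) (use x one in auto)
    have "gram n ((ys @ [z]) @ [lin_comb n u (x # xs)]) = gram n ys + gram n [z, lin_comb n u (x # xs)]"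
      by (simp add: gram_append[symmetric])
    also have "\<dots> = gram n [x] + gram n (ys @ [?h])"
      unfolding rot gram_Cons[of n x "[?h]"] gram_append
      by (intro eq_matI) auto
    also have "\<dots> = gram n (x # xs)"
      unfolding ys(3) gram_Cons[of n x xs] by simp
    finally show ?thesis using ys z by (intro exI[of _ "ys @ [z]"]) simp
  qed
qed

section \<open>Inverse forms under scaling and added noise\<close>

lemma iform_smult:
  assumes "pd_mat n C" "g \<in> carrier_vec n"
  shows "iform C (c \<cdot>\<^sub>v g) = (cmod c)\<^sup>2 * iform C g"
proof -
  have "c \<cdot>\<^sub>v g = c \<cdot>\<^sub>v g + 0 \<cdot>\<^sub>v g" using assms by auto
  then show ?thesis
    using qform_combination[OF pd_minv_hermitian[OF assms(1)] assms(2) assms(2), of c 0]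
    unfolding iform_def by simp
qed

text \<open>More noise lowers the best SINR. Testing the bound for \<open>C\<close> with the
  receiver that is best for \<open>D\<close> avoids comparing the inverses directly; one factor
  \<open>iform D g\<close> cancels at the end.\<close>

lemma iform_antimono:
  assumes C: "pd_mat n C" and D: "pd_mat n D" and g: "g \<in> carrier_vec n"
    and le: "\<And>v. v \<in> carrier_vec n \<Longrightarrow> qform C v \<le> qform D v"
  shows "iform D g \<le> iform C g"
proof (cases "iform D g = 0")
  case True
  then show ?thesis using iform_nonneg[OF C g] by simp
next
  case False
  then have pos: "0 < iform D g" using iform_nonneg[OF D g] by simp
  let ?y = "minv D *\<^sub>v g"
  have y: "?y \<in> carrier_vec n" by (rule pd_minv_vec(1)[OF D g])
  have "(iform D g)\<^sup>2 = (cmod (cinner ?y g))\<^sup>2"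
    unfolding iform_eq(3)[OF D g] by simp
  also have "\<dots> \<le> qform C ?y * iform C g"
    by (rule cinner_sq_le_qform_iform[OF C y g])
  also have "\<dots> \<le> iform D g * iform C g"
    using le[OF y] iform_eq(1)[OF D g] iform_nonneg[OF C g] by (simp add: mult_right_mono)
  finally show ?thesis using pos by (simp add: power2_eq_square)
qed

lemma qform_le_add_gram:
  assumes "pd_mat n C" "set gs \<subseteq> carrier_vec n" "v \<in> carrier_vec n"
  shows "qform C v \<le> qform (C + gram n gs) v"
  using qform_gram_nonneg[OF assms(2,3)] qform_add[OF pd_mat_carrier[OF assms(1)] _ assms(3), of "gram n gs"]
  by simp

lemma gram_mult_vec:
  assumes "set xs \<subseteq> carrier_vec n" "v \<in> carrier_vec n"
  shows "gram n xs *\<^sub>v v = lin_comb n (\<lambda>j. cinner (xs ! j) v) xs"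
  using assms(1)
proof (induction xs)
  case Nil
  then show ?case using assms(2) by (intro eq_vecI) (auto simp: scalar_prod_def)
next
  case (Cons x xs)
  then show ?case
    unfolding gram_Cons[of n x xs]
    using assms(2) by (simp add: add_mult_distrib_mat_vec[of _ n n] gram_single_mult_vec lin_comb_Cons)
qed

text \<open>A Schur complement identity: with \<open>y = (C + G)\<^sup>-\<^sup>1 g\<close> and \<open>G\<close> the Gram matrix of
  \<open>gs\<close>, the vector \<open>C y\<close> is a combination of \<open>g # gs\<close> with leading coefficient \<open>1\<close>.\<close>

lemma iform_add_gram_eq:
  assumes C: "pd_mat n C" and gs: "set gs \<subseteq> carrier_vec n" and g: "g \<in> carrier_vec n"
  shows "\<exists>u. u 0 = 1 \<and> 1 + iform (C + gram n gs) g =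
    iform C (lin_comb n u (g # gs)) + sqnorm u (Suc (length gs))"
proof -
  let ?D = "C + gram n gs"
  have D: "pd_mat n ?D" by (rule pd_add_gram[OF C gs])
  have cc: "C \<in> carrier_mat n n" by (rule pd_mat_carrier[OF C])
  define y where "y = minv ?D *\<^sub>v g"
  have y: "y \<in> carrier_vec n" and Dy: "?D *\<^sub>v y = g"
    unfolding y_def using pd_minv_vec[OF D g] by auto
  have Cy: "C *\<^sub>v y \<in> carrier_vec n" using cc y by auto
  \<comment> \<open>In \<open>g = C y + G y\<close> the last term is the combination of
    \<open>gs\<close> with coefficients \<open>cinner (gs ! j) y\<close>; moving it to the other
    side gives \<open>u\<close>.\<close>
  define u where "u = (\<lambda>j. case j of 0 \<Rightarrow> 1 | Suc j \<Rightarrow> - cinner (gs ! j) y)"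
  have us: "(\<lambda>j. u (Suc j)) = (\<lambda>j. (- 1) * cinner (gs ! j) y)" by (simp add: u_def fun_eq_iff)
  have "g = C *\<^sub>v y + gram n gs *\<^sub>v y"
    using Dy cc y by (simp add: add_mult_distrib_mat_vec[of _ n n])
  then have g_eq: "g = C *\<^sub>v y + lin_comb n (\<lambda>j. cinner (gs ! j) y) gs"
    using gram_mult_vec[OF gs y] by simp
  have "lin_comb n u (g # gs) = 1 \<cdot>\<^sub>v g + lin_comb n (\<lambda>j. u (Suc j)) gs"
    using lin_comb_Cons[OF g, of u gs] by (simp add: u_def)
  also have "\<dots> = g + (- 1) \<cdot>\<^sub>v lin_comb n (\<lambda>j. cinner (gs ! j) y) gs"
    unfolding us lin_comb_smult by simp
  also have "\<dots> = C *\<^sub>v y"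
  proof -
    have "a + b + (- 1) \<cdot>\<^sub>v b = a" if "a \<in> carrier_vec n" "b \<in> carrier_vec n"
      for a b :: "complex vec"
      using that by (intro eq_vecI) auto
    from this[OF Cy lin_comb_carrier] show ?thesis by (subst g_eq)
  qed
  finally have lc: "lin_comb n u (g # gs) = C *\<^sub>v y" .
  have "minv C *\<^sub>v (C *\<^sub>v y) = (minv C * C) *\<^sub>v y"
    using pd_minv(1)[OF C] cc y by (simp add: assoc_mult_mat_vec[of _ n n _ n])
  then have my: "minv C *\<^sub>v (C *\<^sub>v y) = y" using pd_minv(3)[OF C] y by simp
  have 1: "iform C (C *\<^sub>v y) = qform C y"
    using iform_eq(1)[OF C Cy] my by simp
  \<comment> \<open>The 1 is the leading coefficient. The rest is exactly the amount by which
    \<open>qform ?D y\<close> exceeds \<open>qform C y\<close>.\<close>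
  have sq: "sqnorm u (Suc (length gs)) = 1 + qform (gram n gs) y"
  proof -
    have "sqnorm (\<lambda>j. u (Suc j)) (length gs) = (\<Sum>j<length gs. (cmod (cinner y (gs ! j)))\<^sup>2)"
      unfolding sqnorm_def
    proof (rule sum.cong)
      fix j assume "j \<in> {..<length gs}"
      then have "gs ! j \<in> carrier_vec n" using gs by auto
      then show "(cmod (u (Suc j)))\<^sup>2 = (cmod (cinner y (gs ! j)))\<^sup>2"
        using y cinner_commute[of y n "gs ! j"] by (simp add: u_def)
    qed simp
    also have "\<dots> = qform (gram n gs) y"
      unfolding qform_gram[OF gs y] by (simp add: sum_list_sum_nth lessThan_atLeast0)
    finally show ?thesis by (simp add: sqnorm_Suc u_def)
  qed
  have "iform ?D g = qform ?D y" unfolding y_def by (rule iform_eq(1)[OF D g, symmetric])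
  also have "\<dots> = qform C y + qform (gram n gs) y" using cc y by (simp add: qform_add[of _ n])
  finally have "1 + iform ?D g = iform C (lin_comb n u (g # gs)) + sqnorm u (Suc (length gs))"
    unfolding lc 1 sq by simp
  moreover have "u 0 = 1" by (simp add: u_def)
  ultimately show ?thesis by blast
qed

section \<open>Equalizing the factors of the gain\<close>

lemma lin_comb_Cons_0:
  assumes "g \<in> carrier_vec n"
  shows "lin_comb n (case_nat 0 u) (g # gs) = lin_comb n u gs"
  using assms by (simp add: lin_comb_Cons) (auto simp: lin_comb_def)

lemma sqnorm_case_0: "sqnorm (case_nat 0 u) (Suc m) = sqnorm u m"
  by (simp add: sqnorm_Suc)

lemma lin_comb_Cons_unit:
  assumes "g \<in> carrier_vec n"
  shows "lin_comb n (case_nat 1 (\<lambda>_. 0)) (g # gs) = g"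
  using assms by (simp add: lin_comb_Cons lin_comb_zero)

text \<open>By \<open>iform_add_gram_eq\<close> each factor is a value of the form at coefficients
  with leading entry 1. Their squared norm is at least 1, so the factor is at least \<mu>. The
  hypothesis is homogeneous, not restricted to unit vectors, so that it applies to these
  coefficients directly.\<close>

lemma gain_ge_power:
  assumes C: "pd_mat n C" and mu: "0 < \<mu>" and "set gs \<subseteq> carrier_vec n"
    and "\<And>u. sqnorm u (length gs) \<noteq> 0 \<Longrightarrow>
      \<mu> * sqnorm u (length gs) \<le> iform C (lin_comb n u gs) + sqnorm u (length gs)"
  shows "\<mu> ^ length gs \<le> gain n C gs"
  using assms(3,4)
proof (induction gs)
  case (Cons g gs)
  have g: "g \<in> carrier_vec n" and gs: "set gs \<subseteq> carrier_vec n" using Cons.prems by auto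
  have IH: "\<mu> ^ length gs \<le> gain n C gs"
  proof (rule Cons.IH[OF gs])
    fix u assume "sqnorm u (length gs) \<noteq> 0"
    then show "\<mu> * sqnorm u (length gs) \<le> iform C (lin_comb n u gs) + sqnorm u (length gs)"
      using Cons.prems(2)[of "case_nat 0 u"] g
      by (simp add: lin_comb_Cons_0 sqnorm_case_0)
  qed
  obtain u where u: "u 0 = 1" "1 + iform (C + gram n gs) g =
    iform C (lin_comb n u (g # gs)) + sqnorm u (Suc (length gs))"
    using iform_add_gram_eq[OF C gs g] by blast
  have s: "1 \<le> sqnorm u (Suc (length gs))" using u(1) by (simp add: sqnorm_Suc sqnorm_nonneg)
  then have "\<mu> * sqnorm u (Suc (length gs)) \<le> 1 + iform (C + gram n gs) g"
    using Cons.prems(2)[of u] u(2) by simp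
  moreover have "\<mu> * 1 \<le> \<mu> * sqnorm u (Suc (length gs))"
    using s mu by (intro mult_left_mono) auto
  ultimately have "\<mu> \<le> 1 + iform (C + gram n gs) g" by simp
  then show ?case using IH mu by (simp add: mult_mono)
qed simp

text \<open>Interference only lowers a factor, which is therefore at most
  \<open>1 + iform C g\<close>, the value of the form at a coordinate vector.\<close>

lemma gain_le_power:
  assumes C: "pd_mat n C" and mu: "0 < \<mu>" and "set gs \<subseteq> carrier_vec n"
    and "\<And>u. sqnorm u (length gs) \<noteq> 0 \<Longrightarrow>
      iform C (lin_comb n u gs) + sqnorm u (length gs) \<le> \<mu> * sqnorm u (length gs)"
  shows "gain n C gs \<le> \<mu> ^ length gs"
  using assms(3,4)
proof (induction gs)
  case (Cons g gs)
  have g: "g \<in> carrier_vec n" and gs: "set gs \<subseteq> carrier_vec n" using Cons.prems by auto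
  have IH: "gain n C gs \<le> \<mu> ^ length gs"
  proof (rule Cons.IH[OF gs])
    fix u assume "sqnorm u (length gs) \<noteq> 0"
    then show "iform C (lin_comb n u gs) + sqnorm u (length gs) \<le> \<mu> * sqnorm u (length gs)"
      using Cons.prems(2)[of "case_nat 0 u"] g
      by (simp add: lin_comb_Cons_0 sqnorm_case_0)
  qed
  have D: "pd_mat n (C + gram n gs)" by (rule pd_add_gram[OF C gs])
  have "iform (C + gram n gs) g \<le> iform C g"
    by (rule iform_antimono[OF C D g qform_le_add_gram[OF C gs]])
  moreover have "iform C g + 1 \<le> \<mu>"
    using Cons.prems(2)[of "case_nat 1 (\<lambda>_. 0)"] lin_comb_Cons_unit[OF g]
    by (simp add: sqnorm_Suc) (simp add: sqnorm_def)
  ultimately have "1 + iform (C + gram n gs) g \<le> \<mu>" by simp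
  then show ?case using IH mu gain_pos[OF C gs] by (simp add: mult_mono)
qed simp

text \<open>A form above \<mu> on all nonzero coefficients would make the gain exceed
  \<open>\<mu> ^ length gs\<close>, and dually for a form below \<mu>. So the deviation from \<mu>
  takes both signs, and it vanishes somewhere in between.\<close>

lemma exists_unit_combination:
  assumes C: "pd_mat n C" and mu: "0 < \<mu>" and gs: "set gs \<subseteq> carrier_vec n" and ne: "gs \<noteq> []"
    and gain: "gain n C gs = \<mu> ^ length gs"
  shows "\<exists>u. sqnorm u (length gs) = 1 \<and> 1 + iform C (lin_comb n u gs) = \<mu>"
proof -
  define N where "N = length gs"
  \<comment> \<open>The deviation from \<mu>, homogeneous of degree two, so that a nonzero root can
    be scaled to unit norm.\<close>
  define q where "q = (\<lambda>u. iform C (lin_comb n u gs) + sqnorm u N - \<mu> * sqnorm u N)"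
  have q_smult: "q (\<lambda>j. c * u j) = (cmod c)\<^sup>2 * q u" for c u
    by (simp add: q_def lin_comb_smult iform_smult[OF C] sqnorm_smult algebra_simps)
  have q_cong: "q u = q v" if "\<And>j. j < N \<Longrightarrow> u j = v j" for u v
  proof -
    have "lin_comb n u gs = lin_comb n v gs" using that by (intro lin_comb_cong) (simp add: N_def)
    moreover have "sqnorm u N = sqnorm v N" using that by (simp add: sqnorm_def)
    ultimately show ?thesis by (simp add: q_def)
  qed
  obtain g gs' where gs_eq: "gs = g # gs'" using ne by (cases gs) auto
  have g: "g \<in> carrier_vec n" and gs': "set gs' \<subseteq> carrier_vec n" using gs gs_eq by auto
  have N: "N = Suc (length gs')" by (simp add: N_def gs_eq)
  have D: "pd_mat n (C + gram n gs')" by (rule pd_add_gram[OF C gs'])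
  have gain': "gain n C gs = (1 + iform (C + gram n gs') g) * gain n C gs'"
    by (simp add: gs_eq)
  have q0: "q (case_nat 0 u) = iform C (lin_comb n u gs') + sqnorm u (length gs') - \<mu> * sqnorm u (length gs')" for u
    unfolding q_def N gs_eq by (simp add: lin_comb_Cons_0[OF g] sqnorm_case_0)
  have s0: "sqnorm (case_nat 0 u) N = sqnorm u (length gs')" for u
    by (simp add: N sqnorm_case_0)
  have "\<exists>u. sqnorm u N \<noteq> 0 \<and> q u \<le> 0"
  proof (rule ccontr)
    assume "\<not> ?thesis"
    then have all: "\<And>u. sqnorm u N \<noteq> 0 \<Longrightarrow> 0 < q u" by force
    \<comment> \<open>The tail is bounded weakly, through combinations with leading coefficient 0.
      Strictness comes from the head factor alone and survives in the product because all factors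
      are positive.\<close>
    have "\<mu> ^ length gs' \<le> gain n C gs'"
    proof (rule gain_ge_power[OF C mu gs'])
      fix u assume "sqnorm u (length gs') \<noteq> 0"
      then show "\<mu> * sqnorm u (length gs') \<le> iform C (lin_comb n u gs') + sqnorm u (length gs')"
        using all[of "case_nat 0 u"] by (simp add: q0 s0)
    qed
    moreover obtain u where u: "u 0 = 1" "1 + iform (C + gram n gs') g =
      iform C (lin_comb n u (g # gs')) + sqnorm u (Suc (length gs'))"
      using iform_add_gram_eq[OF C gs' g] by blast
    have s: "1 \<le> sqnorm u N" using u(1) by (simp add: N sqnorm_Suc sqnorm_nonneg)
    then have "\<mu> * sqnorm u N < 1 + iform (C + gram n gs') g"
      using all[of u] u(2) by (simp add: q_def gs_eq N)
    moreover have "\<mu> * 1 \<le> \<mu> * sqnorm u N" using s mu by (intro mult_left_mono) auto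
    moreover from calculation have "\<mu> < 1 + iform (C + gram n gs') g" by linarith
    ultimately have "\<mu> * \<mu> ^ length gs' < (1 + iform (C + gram n gs') g) * gain n C gs'"
      using mu by (intro mult_less_le_imp_less) auto
    then show False using gain gain' by (simp add: gs_eq)
  qed
  then obtain u1 where u1: "sqnorm u1 N \<noteq> 0" "q u1 \<le> 0" by blast
  have "\<exists>u. sqnorm u N \<noteq> 0 \<and> 0 \<le> q u"
  proof (rule ccontr)
    assume "\<not> ?thesis"
    then have all: "\<And>u. sqnorm u N \<noteq> 0 \<Longrightarrow> q u < 0" by force
    have "gain n C gs' \<le> \<mu> ^ length gs'"
    proof (rule gain_le_power[OF C mu gs'])
      fix u assume "sqnorm u (length gs') \<noteq> 0"
      then show "iform C (lin_comb n u gs') + sqnorm u (length gs') \<le> \<mu> * sqnorm u (length gs')"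
        using all[of "case_nat 0 u"] by (simp add: q0 s0)
    qed
    moreover have "iform (C + gram n gs') g \<le> iform C g"
      by (rule iform_antimono[OF C D g qform_le_add_gram[OF C gs']])
    moreover have "iform C g + 1 < \<mu>"
    proof -
      have "sqnorm (case_nat 1 (\<lambda>_. 0)) N = 1" by (simp add: N sqnorm_Suc) (simp add: sqnorm_def)
      then show ?thesis
        using all[of "case_nat 1 (\<lambda>_. 0)"] lin_comb_Cons_unit[OF g] by (simp add: q_def gs_eq)
    qed
    ultimately have "(1 + iform (C + gram n gs') g) * gain n C gs' < \<mu> * \<mu> ^ length gs'"
      using mu gain_pos[OF C gs'] iform_nonneg[OF D g] by (intro mult_less_le_imp_less) auto
    then show False using gain gain' by (simp add: gs_eq)
  qed
  then obtain u2 where u2: "sqnorm u2 N \<noteq> 0" "0 \<le> q u2" by blast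
  have "\<exists>u. sqnorm u N \<noteq> 0 \<and> q u = 0"
  proof (cases "q u1 = 0 \<or> q u2 = 0")
    case True
    then show ?thesis using u1 u2 by blast
  next
    case False
    then have neg: "q u1 < 0" and pos: "0 < q u2" using u1 u2 by auto
    \<comment> \<open>A straight segment instead of a path on the unit sphere: \<open>q\<close>
      along it is a polynomial in \<open>t\<close>. Passage through the origin is excluded
      below.\<close>
    define w where "w = (\<lambda>(t::real) j. of_real (1 - t) * u1 j + of_real t * u2 j)"
    have herm: "hermitian_mat n (minv C)" by (rule pd_minv_hermitian[OF C])
    define c where "c = cinner (lin_comb n u1 gs) (minv C *\<^sub>v lin_comb n u2 gs)"
    have qw: "q (w t) = (1 - t)\<^sup>2 * iform C (lin_comb n u1 gs) + 2 * ((1 - t) * t * Re c)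
        + t\<^sup>2 * iform C (lin_comb n u2 gs) + (1 - \<mu>) * sqnorm (w t) N" for t
    proof -
      have "lin_comb n (w t) gs = of_real (1 - t) \<cdot>\<^sub>v lin_comb n u1 gs + of_real t \<cdot>\<^sub>v lin_comb n u2 gs"
        unfolding w_def lin_comb_add lin_comb_smult ..
      then have "iform C (lin_comb n (w t) gs) = (cmod (of_real (1 - t)))\<^sup>2 * iform C (lin_comb n u1 gs)
        + 2 * Re (cnj (of_real (1 - t)) * of_real t * c) + (cmod (of_real t))\<^sup>2 * iform C (lin_comb n u2 gs)"
        unfolding iform_def c_def by (simp only: qform_combination[OF herm lin_comb_carrier lin_comb_carrier])
      also have "cnj (of_real (1 - t)) * of_real t * c = of_real ((1 - t) * t) * c" by simp
      also have "Re (of_real ((1 - t) * t) * c) = (1 - t) * t * Re c" by (simp only: Re_complex_of_real Im_complex_of_real times_complex.simps)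
      finally show ?thesis
        by (simp only: q_def norm_of_real power2_abs) (simp add: algebra_simps)
    qed
    have "continuous_on {0..1} (\<lambda>t. q (w t))"
      unfolding qw sqnorm_def by (auto simp: w_def intro!: continuous_intros)
    moreover have "w 0 = u1" "w 1 = u2" by (auto simp: w_def)
    ultimately obtain t where t: "0 \<le> t" "t \<le> 1" "q (w t) = 0"
      using IVT'[of "\<lambda>t. q (w t)" 0 0 1] neg pos by auto
    \<comment> \<open>At the origin \<open>t * u2 = (t - 1) * u1\<close>, and homogeneity equates a
      nonnegative multiple of \<open>q u2\<close> with a nonpositive quantity. Both vanish, which
      would require \<open>t = 0\<close> and \<open>t = 1\<close>.\<close>
    have "sqnorm (w t) N \<noteq> 0"
    proof
      assume z: "sqnorm (w t) N = 0"
      then have wz: "\<And>j. j < N \<Longrightarrow> of_real t * u2 j = of_real (t - 1) * u1 j"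
        unfolding sqnorm_eq_0_iff by (simp add: w_def algebra_simps add_eq_0_iff)
      have "t\<^sup>2 * q u2 = q (\<lambda>j. of_real t * u2 j)" by (simp add: q_smult)
      also have "\<dots> = q (\<lambda>j. of_real (t - 1) * u1 j)" by (rule q_cong) (rule wz)
      also have "\<dots> = (t - 1)\<^sup>2 * q u1" unfolding q_smult norm_of_real by simp
      finally have eq: "t\<^sup>2 * q u2 = (t - 1)\<^sup>2 * q u1" .
      have "0 \<le> t\<^sup>2 * q u2" using pos by simp
      moreover have "(t - 1)\<^sup>2 * q u1 \<le> 0" using neg by (simp add: mult_nonneg_nonpos)
      ultimately have "t\<^sup>2 * q u2 = 0" "(t - 1)\<^sup>2 * q u1 = 0" using eq by linarith+
      then show False using neg pos by simp
    qed
    then show ?thesis using t(3) by blast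
  qed
  then obtain u where u: "sqnorm u N \<noteq> 0" "q u = 0" by blast
  define s where "s = sqnorm u N"
  have s: "0 < s" using u(1) sqnorm_nonneg[of u N] by (simp add: s_def)
  define v where "v = (\<lambda>j. of_real (1 / sqrt s) * u j)"
  have "sqnorm v N = (cmod (of_real (1 / sqrt s)))\<^sup>2 * s"
    unfolding v_def s_def by (rule sqnorm_smult)
  also have "\<dots> = 1" using s unfolding norm_of_real power2_abs by (simp add: power_divide)
  finally have 1: "sqnorm v N = 1" .
  have "q v = 0" unfolding v_def q_smult using u(2) by simp
  then have "1 + iform C (lin_comb n v gs) = \<mu>" using 1 by (simp add: q_def)
  then show ?thesis using 1 by (auto simp: N_def)
qed

text \<open>Stated for transmit vectors, because the Gram matrix to be kept is the transmit
  covariance. The noise \<open>C\<close> varies in the induction, as each extracted stream joins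
  it.\<close>

lemma equalize_gain:
  assumes H: "H \<in> carrier_mat m n" and mu: "0 < \<mu>"
    and "pd_mat m C" "set bs \<subseteq> carrier_vec n"
    and "gain m C (map ((*\<^sub>v) H) bs) = \<mu> ^ length bs"
  shows "\<exists>bs'. length bs' = length bs \<and> set bs' \<subseteq> carrier_vec n \<and> gram n bs' = gram n bs \<and>
    (\<forall>i<length bs. 1 + iform (C + gram m (map ((*\<^sub>v) H) (drop (Suc i) bs'))) (H *\<^sub>v bs' ! i) = \<mu>)"
  using assms(3-)
proof (induction "length bs" arbitrary: C bs)
  case 0
  then show ?case by (intro exI[of _ bs]) simp
next
  case (Suc N)
  note C = Suc.prems(1) and bs = Suc.prems(2)
  let ?M = "map ((*\<^sub>v) H)"
  have HC: "set (?M xs) \<subseteq> carrier_vec m" if "set xs \<subseteq> carrier_vec n" for xs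
    using that H by auto
  have "bs \<noteq> []" using Suc.hyps(2) by auto
  then obtain u where u: "sqnorm u (length bs) = 1"
      "1 + iform C (lin_comb m u (?M bs)) = \<mu>"
    using exists_unit_combination[OF C mu HC[OF bs]] Suc.prems(3) by auto
  obtain ys where ys: "Suc (length ys) = length bs" "set ys \<subseteq> carrier_vec n"
      "gram n (ys @ [lin_comb n u bs]) = gram n bs"
    using gram_combination[OF bs u(1)] by blast
  define b where "b = lin_comb n u bs"
  have b: "b \<in> carrier_vec n" by (simp add: b_def)
  have Hb: "H *\<^sub>v b = lin_comb m u (?M bs)"
    unfolding b_def by (rule mult_lin_comb[OF H bs])
  have Hbc: "H *\<^sub>v b \<in> carrier_vec m" unfolding Hb by simp
  define D where "D = C + gram m [H *\<^sub>v b]"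
  have D: "pd_mat m D" unfolding D_def by (rule pd_add_gram[OF C]) (use Hbc in simp)
  have gram_eq: "gram n (ys @ [b]) = gram n bs" using ys(3) by (simp add: b_def)
  have ysb: "set (ys @ [b]) \<subseteq> carrier_vec n" using ys b by simp
  have "gain m C (?M (ys @ [b])) = gain m C (?M bs)"
  proof (rule gain_cong_gram[OF C HC[OF ysb] HC[OF bs]])
    show "gram m (?M (ys @ [b])) = gram m (?M bs)"
      using gram_map_mult[OF H ysb] gram_map_mult[OF H bs] gram_eq by simp
  qed
  moreover have "gain m C (?M (ys @ [b])) = gain m D (?M ys) * \<mu>"
    using gain_append[OF pd_mat_carrier[OF C], of "?M ys" "[H *\<^sub>v b]"] u(2) Hb pd_mat_carrier[OF C]
    by (simp add: D_def)
  \<comment> \<open>The factor of \<open>b\<close> is \<mu> and cancels, so the remaining vectors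
    again have geometric mean \<mu>, now against the noise \<open>D\<close>.\<close>
  ultimately have "gain m D (?M ys) * \<mu> = \<mu> ^ length ys * \<mu>"
    using Suc.prems(3) ys(1)[symmetric] by auto
  then have "gain m D (?M ys) = \<mu> ^ length ys" using mu by simp
  moreover have "N = length ys" using ys(1) Suc.hyps(2) by simp
  ultimately obtain ys' where ys': "length ys' = length ys" "set ys' \<subseteq> carrier_vec n"
    "gram n ys' = gram n ys"
    "\<And>i. i < length ys \<Longrightarrow> 1 + iform (D + gram m (?M (drop (Suc i) ys'))) (H *\<^sub>v ys' ! i) = \<mu>"
    using Suc.hyps(1)[OF _ D ys(2)] by blast
  have "1 + iform (C + gram m (?M (drop (Suc i) (ys' @ [b])))) (H *\<^sub>v (ys' @ [b]) ! i) = \<mu>"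
    if i: "i < length bs" for i
  proof (cases "i < length ys")
    case True
    have "C + gram m (?M (drop (Suc i) (ys' @ [b]))) = D + gram m (?M (drop (Suc i) ys'))"
      using True ys'(1) pd_mat_carrier[OF C] unfolding D_def
      by (simp add: gram_append) (intro eq_matI, auto)
    then show ?thesis using ys'(4)[OF True] ys'(1) True by (simp add: nth_append)
  next
    case False
    then have "i = length ys'" using i ys(1) ys'(1) by simp
    then show ?thesis using u(2) Hb pd_mat_carrier[OF C] by simp
  qed
  moreover have "gram n (ys' @ [b]) = gram n bs"
    using gram_eq ys'(3) by (simp add: gram_append)
  ultimately show ?case using ys' ys b by (intro exI[of _ "ys' @ [b]"]) auto
qed

section \<open>Cholesky factorization\<close>

lemma hermitian_index:
  assumes "hermitian_mat n S" "i < n" "j < n"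
  shows "S $$ (j, i) = cnj (S $$ (i, j))"
  using assms mat_adjoint_index[of j S i] by (auto simp: hermitian_mat_def)

lemma cinner_unit_left:
  assumes "i < n" "v \<in> carrier_vec n"
  shows "cinner (unit_vec n i) v = v $ i"
  using assms
  by (simp add: cinner_def unit_vec_def if_distrib[of cnj] if_distrib[of "\<lambda>x. x * _"] sum.If_cases cong: if_cong)

text \<open>Row-by-row elimination; the first \<open>k\<close> rows are already cleared, and by
  symmetry the first \<open>k\<close> columns too. Zero vectors pad the list to its exact length,
  because the reduction to \<open>rank H\<close> vectors has to start from at least that
  many.\<close>

lemma psd_factorization_aux:
  assumes "psd_mat n S" "k \<le> n" "\<And>i j. i < k \<Longrightarrow> j < n \<Longrightarrow> S $$ (i, j) = 0"
  shows "\<exists>xs. length xs = n - k \<and> set xs \<subseteq> carrier_vec n \<and> gram n xs = S"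
  using assms
proof (induction "n - k" arbitrary: S k)
  case 0
  then have "S = 0\<^sub>m n n" by (intro eq_matI) (auto simp: psd_mat_def)
  then show ?case using 0 by (intro exI[of _ "[]"]) simp
next
  case (Suc d)
  then have k: "k < n" and d: "d = n - Suc k" by auto
  note psd = Suc.prems(1)
  have herm: "hermitian_mat n S" and nn: "\<And>v. v \<in> carrier_vec n \<Longrightarrow> 0 \<le> qform S v"
    using psd by (auto simp: psd_mat_iff)
  have Sc: "S \<in> carrier_mat n n" using herm by (simp add: hermitian_mat_def)
  let ?e = "unit_vec n k"
  have e: "?e \<in> carrier_vec n" by simp
  have Se: "S *\<^sub>v ?e = col S k"
    using Sc k by (intro eq_vecI) auto
  have ent: "cinner (unit_vec n i) (S *\<^sub>v unit_vec n j) = S $$ (i, j)" if "i < n" "j < n" for i j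
    using that Sc by (simp add: cinner_unit_left)
  define s where "s = qform S ?e"
  have s_eq: "S $$ (k, k) = of_real s"
    using hermitian_cinner_self[OF herm e] ent[OF k k] by (simp add: s_def)
  have s0: "0 \<le> s" using nn[OF e] by (simp add: s_def)
  show ?case
  proof (cases "s = 0")
    case True
    \<comment> \<open>With a zero pivot, Cauchy-Schwarz forces the whole row to vanish.\<close>
    have row: "S $$ (k, j) = 0" if "j < n" for j
      using psd_Cauchy_Schwarz[OF psd e, of "unit_vec n j"] ent[OF k that] True by (simp add: s_def)
    have "\<exists>xs. length xs = n - Suc k \<and> set xs \<subseteq> carrier_vec n \<and> gram n xs = S"
      by (rule Suc.hyps(1)[OF d psd]) (use k row Suc.prems(3) in \<open>auto simp: less_Suc_eq\<close>)
    then obtain xs where xs: "length xs = n - Suc k" "set xs \<subseteq> carrier_vec n" "gram n xs = S" by blast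
    have "gram n (0\<^sub>v n # xs) = S"
      unfolding xs(3)[symmetric] by (intro eq_matI) (auto simp: gram_def)
    then show ?thesis using xs k by (intro exI[of _ "0\<^sub>v n # xs"]) auto
  next
    case False
    then have s: "0 < s" using s0 by simp
    \<comment> \<open>Column \<open>k\<close> over the square root of its pivot, so that
      \<open>x x^H\<close> reproduces row and column \<open>k\<close> of \<open>S\<close>.\<close>
    define x where "x = of_real (1 / sqrt s) \<cdot>\<^sub>v (S *\<^sub>v ?e)"
    have x: "x \<in> carrier_vec n" using Sc by (simp add: x_def)
    have ss: "complex_of_real (1 / sqrt s) * of_real (1 / sqrt s) = of_real (1 / s)"
      using s by (simp add: of_real_mult[symmetric] del: of_real_mult of_real_divide)
    have xx: "x $ i * cnj (x $ j) = of_real (1 / s) * (S $$ (i, k) * S $$ (k, j))"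
      if "i < n" "j < n" for i j
    proof -
      have "x $ i * cnj (x $ j) = (of_real (1 / sqrt s) * of_real (1 / sqrt s)) * (S $$ (i, k) * cnj (S $$ (j, k)))"
        using that Sc k unfolding x_def Se by simp
      then show ?thesis unfolding ss using hermitian_index[OF herm that(2) k] by simp
    qed
    define S' where "S' = mat n n (\<lambda>(i, j). S $$ (i, j) - x $ i * cnj (x $ j))"
    have S'c: "S' \<in> carrier_mat n n" by (simp add: S'_def)
    have split: "S = gram n [x] + S'" using Sc by (intro eq_matI) (auto simp: S'_def gram_def)
    have "mat_adjoint S' = S'"
    proof (rule eq_matI)
      fix i j assume "i < dim_row S'" "j < dim_col S'"
      then have ij: "i < n" "j < n" by (auto simp: S'_def)
      show "mat_adjoint S' $$ (i, j) = S' $$ (i, j)"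
        using ij hermitian_index[OF herm ij] by (simp add: S'_def mult.commute)
    qed (auto simp: S'_def)
    then have herm': "hermitian_mat n S'" using S'c by (simp add: hermitian_mat_def)
    \<comment> \<open>What is removed is \<open>|v^H S e_k|^2 / s\<close>, at most
      \<open>qform S v\<close> by Cauchy-Schwarz.\<close>
    have "0 \<le> qform S' v" if v: "v \<in> carrier_vec n" for v
    proof -
      have "(cmod (cinner v x))\<^sup>2 = (1 / s) * (cmod (cinner v (S *\<^sub>v ?e)))\<^sup>2"
        unfolding x_def using s v Sc
        by (simp add: cinner_smult_right[of _ n] norm_mult norm_divide power_mult_distrib power_divide)
      also have "\<dots> \<le> (1 / s) * (qform S v * s)"
        using psd_Cauchy_Schwarz[OF psd v e] s by (intro mult_left_mono) (auto simp: s_def)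
      also have "\<dots> = qform S v" using s by simp
      also have "qform S v = (cmod (cinner v x))\<^sup>2 + qform S' v"
        using v x S'c by (subst split) (simp add: qform_add[of _ n] qform_gram_single)
      finally show ?thesis by simp
    qed
    then have psd': "psd_mat n S'" using herm' by (simp add: psd_mat_iff)
    have zero: "S' $$ (i, j) = 0" if "i < Suc k" "j < n" for i j
    proof (cases "i = k")
      case True
      then show ?thesis using that k s xx[OF k that(2)] by (simp add: S'_def s_eq)
    next
      case False
      then have "i < k" using that by simp
      then show ?thesis using that k xx[of i j] Suc.prems(3)[of i] by (simp add: S'_def)
    qed
    have "\<exists>xs. length xs = n - Suc k \<and> set xs \<subseteq> carrier_vec n \<and> gram n xs = S'"
      by (rule Suc.hyps(1)[OF d psd']) (use k zero in auto)
    then obtain xs where xs: "length xs = n - Suc k" "set xs \<subseteq> carrier_vec n" "gram n xs = S'" by blast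
    have "gram n (x # xs) = S" unfolding gram_Cons[of n x xs] xs(3) by (rule split[symmetric])
    then show ?thesis using xs x k by (intro exI[of _ "x # xs"]) auto
  qed
qed

lemma psd_factorization:
  assumes "psd_mat n S"
  obtains xs where "length xs = n" "set xs \<subseteq> carrier_vec n" "gram n xs = S"
  using psd_factorization_aux[OF assms, of 0] by auto

section \<open>Rank and receivers\<close>

lemma underdetermined_system:
  fixes K :: "nat \<Rightarrow> nat \<Rightarrow> complex"
  assumes "r < N"
  shows "\<exists>u. (\<exists>k<N. u k \<noteq> 0) \<and> (\<forall>i<r. (\<Sum>k<N. K i k * u k) = 0)"
proof -
  \<comment> \<open>Zero rows pad the system to a square one. Row \<open>r\<close> is among them, so
    the transpose kills \<open>unit_vec N r\<close> and the determinant is 0.\<close>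
  define A where "A = mat N N (\<lambda>(i, k). if i < r then K i k else 0)"
  have A: "A \<in> carrier_mat N N" by (simp add: A_def)
  have "transpose_mat A *\<^sub>v unit_vec N r = 0\<^sub>v N"
    using assms A by (intro eq_vecI) (auto simp: A_def)
  moreover have "unit_vec N r \<noteq> (0\<^sub>v N :: complex vec)"
    using assms by (metis index_unit_vec(2) index_zero_vec(1) one_neq_zero)
  ultimately have "det (transpose_mat A) = 0"
    using det_0_iff_vec_prod_zero[of "transpose_mat A" N] A
    by (metis transpose_carrier_mat unit_vec_carrier)
  then have "det A = 0" using det_transpose[OF A] by simp
  then obtain v where v: "v \<in> carrier_vec N" "v \<noteq> 0\<^sub>v N" "A *\<^sub>v v = 0\<^sub>v N"
    using det_0_iff_vec_prod_zero[OF A] by auto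
  have "\<exists>k<N. v $ k \<noteq> 0" using v(1,2) by (auto intro!: eq_vecI)
  moreover have "(\<Sum>k<N. K i k * v $ k) = 0" if "i < r" for i
  proof -
    have i: "i < N" using that assms by simp
    have "(\<Sum>k<N. K i k * v $ k) = (\<Sum>k<N. A $$ (i, k) * v $ k)"
      using i that by (simp add: A_def)
    also have "\<dots> = (A *\<^sub>v v) $ i"
      by (rule mult_mat_vec_index[OF A v(1) i, symmetric])
    also have "\<dots> = 0" unfolding v(3) using i by simp
    finally show ?thesis .
  qed
  ultimately show ?thesis by (intro exI[of _ "\<lambda>k. v $ k"]) blast
qed

text \<open>The \<open>f w\<close> are a maximal independent set of columns and \<open>c w j\<close>
  the coordinates of column \<open>j\<close> in it. In this form, \<open>rank H\<close> scalar
  equations suffice for a vector to lie in the kernel.\<close>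

lemma rank_factorization:
  fixes H :: "complex mat"
  assumes H: "H \<in> carrier_mat m n"
  shows "\<exists>f c. \<forall>i<m. \<forall>j<n. H $$ (i, j) = (\<Sum>w<vec_space.rank m H. c w j * f w i)"
proof -
  interpret vec_space "TYPE(complex)" m .
  have cols: "set (cols H) \<subseteq> carrier_vec m" using cols_dim H by blast
  obtain U where max: "maximal U (\<lambda>T. T \<subseteq> set (cols H) \<and> lin_indpt T)" and finU: "finite U"
    using maximal_exists_superset[of "set (cols H)" "\<lambda>T. T \<subseteq> set (cols H) \<and> lin_indpt T" "{}"]
      finite_lin_indpt2[of "{}"] by auto
  have U: "U \<subseteq> set (cols H)" "lin_indpt U" using max by (auto simp: maximal_def)
  have Uc: "U \<subseteq> carrier_vec m" using U cols by blast
  have rk: "rank H = card U" by (rule rank_card_indpt[OF H max])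
  have sp: "h \<in> span U" if h: "h \<in> set (cols H)" for h
  proof (cases "h \<in> U")
    case True
    then show ?thesis using span_mem[of U h] Uc by auto
  next
    case False
    have "\<not> (U \<union> {h} \<subseteq> set (cols H) \<and> lin_indpt (U \<union> {h}))"
      using max False unfolding maximal_def by blast
    then have "lin_dep (U \<union> {h})" using U h by blast
    then show ?thesis
      using lin_dep_iff_in_span[of U h] Uc U(2) False h cols by auto
  qed
  have "\<exists>a. h = lincomb a U" if "h \<in> set (cols H)" for h
    using sp[OF that] finite_span[OF finU] Uc by auto
  then obtain a where a: "\<And>h. h \<in> set (cols H) \<Longrightarrow> h = lincomb (a h) U" by metis
  obtain f where f: "bij_betw f {..<card U} U"
    using ex_bij_betw_nat_finite[OF finU] by (auto simp: lessThan_atLeast0)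
  have "H $$ (i, j) = (\<Sum>w<card U. a (col H j) (f w) * f w $ i)" if i: "i < m" and j: "j < n" for i j
  proof -
    have hc: "col H j \<in> set (cols H)" using j H by (auto simp: cols_def)
    have "H $$ (i, j) = col H j $ i" using i j H by simp
    also have "\<dots> = lincomb (a (col H j)) U $ i" using a[OF hc] by simp
    also have "\<dots> = (\<Sum>x\<in>U. a (col H j) x * x $ i)" by (rule lincomb_index[OF i Uc])
    also have "\<dots> = (\<Sum>w<card U. a (col H j) (f w) * f w $ i)"
      by (rule sum.reindex_bij_betw[OF f, symmetric])
    finally show ?thesis .
  qed
  then have "\<forall>i<m. \<forall>j<n. H $$ (i, j) = (\<Sum>w<rank H. a (col H j) (f w) * f w $ i)"
    unfolding rk by simp
  then show ?thesis
    by (intro exI[of _ "\<lambda>w i. f w $ i"] exI[of _ "\<lambda>w j. a (col H j) (f w)"])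
qed

text \<open>Each inner index \<open>w\<close> of the factorization gives one linear equation for the
  coefficients \<open>u\<close>, and there are more coefficients than equations.\<close>

lemma exists_unit_in_kernel:
  assumes H: "H \<in> carrier_mat m n" and bs: "set bs \<subseteq> carrier_vec n"
    and len: "vec_space.rank m H < length bs"
  shows "\<exists>u. sqnorm u (length bs) = 1 \<and> H *\<^sub>v lin_comb n u bs = 0\<^sub>v m"
proof -
  let ?N = "length bs"
  obtain f c where fc: "\<And>i j. i < m \<Longrightarrow> j < n \<Longrightarrow> H $$ (i, j) = (\<Sum>w<vec_space.rank m H. c w j * f w i)"
    using rank_factorization[OF H] by blast
  obtain u where u: "\<exists>k<?N. u k \<noteq> 0"
    "\<And>w. w < vec_space.rank m H \<Longrightarrow> (\<Sum>k<?N. (\<Sum>j<n. c w j * bs ! k $ j) * u k) = 0"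
    using underdetermined_system[OF len, of "\<lambda>w k. \<Sum>j<n. c w j * bs ! k $ j"] by blast
  have Hu: "H *\<^sub>v lin_comb n u bs = 0\<^sub>v m"
  proof (rule eq_vecI)
    fix i assume "i < dim_vec (0\<^sub>v m :: complex vec)"
    then have i: "i < m" by simp
    have "(H *\<^sub>v lin_comb n u bs) $ i = (\<Sum>j<n. H $$ (i, j) * (lin_comb n u bs) $ j)"
      by (rule mult_mat_vec_index[OF H lin_comb_carrier i])
    also have "\<dots> = (\<Sum>j<n. \<Sum>w<vec_space.rank m H. \<Sum>k<?N. f w i * (c w j * bs ! k $ j * u k))"
      using i by (intro sum.cong) (simp_all add: fc lin_comb_def sum_product mult_ac)
    also have "\<dots> = (\<Sum>w<vec_space.rank m H. \<Sum>j<n. \<Sum>k<?N. f w i * (c w j * bs ! k $ j * u k))"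
      by (rule sum.swap)
    also have "\<dots> = (\<Sum>w<vec_space.rank m H. f w i * (\<Sum>k<?N. (\<Sum>j<n. c w j * bs ! k $ j) * u k))"
      by (subst sum.swap) (simp add: sum_distrib_left sum_distrib_right)
    also have "\<dots> = 0" by (simp add: u(2))
    finally show "(H *\<^sub>v lin_comb n u bs) $ i = 0\<^sub>v m $ i" using i by simp
  qed (use H in simp)
  define s where "s = sqnorm u ?N"
  have "s \<noteq> 0" using u(1) by (simp add: s_def sqnorm_eq_0_iff)
  then have s: "0 < s" using sqnorm_nonneg[of u ?N] by (simp add: s_def)
  define v where "v = (\<lambda>j. of_real (1 / sqrt s) * u j)"
  have "sqnorm v ?N = (cmod (of_real (1 / sqrt s)))\<^sup>2 * s"
    unfolding v_def s_def by (rule sqnorm_smult)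
  also have "\<dots> = 1" using s unfolding norm_of_real power2_abs by (simp add: power_divide)
  finally have "sqnorm v ?N = 1" .
  moreover have "H *\<^sub>v lin_comb n v bs = 0\<^sub>v m"
    unfolding v_def lin_comb_smult using H Hu by (auto simp: mult_mat_vec[of _ m n] intro!: eq_vecI)
  ultimately show ?thesis by blast
qed

text \<open>Kernel vectors are split off one at a time until \<open>rank H\<close> vectors remain.
  They are kept as \<open>ds\<close>, so that the Gram identity stays exact; their norms later
  measure the power saved.\<close>

lemma gram_rank_reduction:
  assumes H: "H \<in> carrier_mat m n" and "set bs \<subseteq> carrier_vec n"
    and "vec_space.rank m H \<le> length bs"
  shows "\<exists>cs ds. length cs = vec_space.rank m H \<and> set cs \<subseteq> carrier_vec n \<and> set ds \<subseteq> carrier_vec n \<and>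
    gram n (cs @ ds) = gram n bs \<and> (\<forall>d\<in>set ds. H *\<^sub>v d = 0\<^sub>v m)"
  using assms(2,3)
proof (induction "length bs - vec_space.rank m H" arbitrary: bs)
  case 0
  then show ?case by (intro exI[of _ bs] exI[of _ "[]"]) simp
next
  case (Suc k)
  have "vec_space.rank m H < length bs" using Suc.hyps(2) by simp
  then obtain u where u: "sqnorm u (length bs) = 1" "H *\<^sub>v lin_comb n u bs = 0\<^sub>v m"
    using exists_unit_in_kernel[OF H Suc.prems(1)] by blast
  let ?d = "lin_comb n u bs"
  obtain ys where ys: "Suc (length ys) = length bs" "set ys \<subseteq> carrier_vec n"
      "gram n (ys @ [?d]) = gram n bs"
    using gram_combination[OF Suc.prems(1) u(1)] by blast
  have "k = length ys - vec_space.rank m H" "vec_space.rank m H \<le> length ys"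
    using Suc.hyps(2) ys(1) by auto
  then obtain cs ds where cd: "length cs = vec_space.rank m H" "set cs \<subseteq> carrier_vec n"
      "set ds \<subseteq> carrier_vec n" "gram n (cs @ ds) = gram n ys" "\<forall>d\<in>set ds. H *\<^sub>v d = 0\<^sub>v m"
    using Suc.hyps(1)[of ys] ys(2) by blast
  have "gram n (cs @ (ds @ [?d])) = gram n bs"
    using cd(4) ys(3) by (metis append.assoc gram_append)
  then show ?case using cd u(2) by (intro exI[of _ cs] exI[of _ "ds @ [?d]"]) auto
qed

text \<open>The direction \<open>C^-1 g\<close> gives equality in Cauchy-Schwarz, and normalizing it
  scales both sides alike.\<close>

lemma mmse_receiver:
  assumes C: "pd_mat m C" and g: "g \<in> carrier_vec m" and ne: "g \<noteq> 0\<^sub>v m"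
  shows "\<exists>r\<in>carrier_vec m. cvnorm r = 1 \<and> (cmod (cinner r g))\<^sup>2 = iform C g * qform C r"
proof -
  define y where "y = minv C *\<^sub>v g"
  have y: "y \<in> carrier_vec m" and Cy: "C *\<^sub>v y = g" using pd_minv_vec[OF C g] by (auto simp: y_def)
  have "y \<noteq> 0\<^sub>v m" using iform_eq(3)[OF C g] iform_pos[OF C g ne] unfolding y_def[symmetric]
    by (auto simp: cinner_def)
  then have s: "0 < Re (cinner y y)"
    using cinner_self_eq_0[OF y] cinner_self_Re_nonneg[of y] by fastforce
  define a where "a = 1 / sqrt (Re (cinner y y))"
  have a: "a\<^sup>2 * Re (cinner y y) = 1" using s by (simp add: a_def power_divide)
  define r where "r = of_real a \<cdot>\<^sub>v y"
  have r: "r \<in> carrier_vec m" using y by (simp add: r_def)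
  have "cinner r r = of_real (a\<^sup>2) * cinner y y"
    using y by (simp add: r_def cinner_smult_left cinner_smult_right[of _ m] power2_eq_square)
  then have 1: "cvnorm r = 1" using a by (simp add: cvnorm_eq_1_iff)
  have "cinner r g = of_real a * of_real (iform C g)"
    unfolding r_def cinner_smult_left y_def iform_eq(3)[OF C g] by simp
  then have "(cmod (cinner r g))\<^sup>2 = a\<^sup>2 * (iform C g)\<^sup>2"
    by (simp add: norm_mult power_mult_distrib)
  moreover have "r = of_real a \<cdot>\<^sub>v y + 0 \<cdot>\<^sub>v y" using y by (auto simp: r_def)
  then have "qform C r = a\<^sup>2 * iform C g"
    using qform_combination[of m C y y "of_real a" 0] C y iform_eq(1)[OF C g]
    by (simp add: pd_mat_def y_def)
  ultimately show ?thesis using r 1 by (auto simp: power2_eq_square)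
qed

text \<open>One link against a fixed noise \<open>C\<close>. The SINR condition is multiplied out so
  that the noise can later be replaced by a smaller one, and the \<open>bs\<close> are nonzero so
  that they can be normalized to transmit vectors.\<close>

lemma link_decomposition:
  assumes H: "H \<in> carrier_mat m n" and S: "psd_mat n S" and C: "pd_mat m C"
    and I: "0 < I" and rate: "I \<le> ln (cmod (det (1\<^sub>m m + H * S * mat_adjoint H * minv C)))"
  shows "\<exists>bs rs ds. length bs = vec_space.rank m H \<and> set bs \<subseteq> carrier_vec n \<and> set ds \<subseteq> carrier_vec n \<and>
    gram n (bs @ ds) = S \<and>
    (\<forall>i<vec_space.rank m H. bs ! i \<noteq> 0\<^sub>v n \<and> rs i \<in> carrier_vec m \<and> cvnorm (rs i) = 1 \<and>
      (exp (I / real (vec_space.rank m H)) - 1) * qform (C + gram m (map ((*\<^sub>v) H) (drop (Suc i) bs))) (rs i)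
        \<le> (cmod (cinner (rs i) (H *\<^sub>v bs ! i)))\<^sup>2)"
proof -
  let ?M = "map ((*\<^sub>v) H)"
  let ?r = "vec_space.rank m H"
  obtain xs where xs: "length xs = n" "set xs \<subseteq> carrier_vec n" "gram n xs = S"
    using psd_factorization[OF S] .
  obtain cs ds where cd: "length cs = ?r" "set cs \<subseteq> carrier_vec n" "set ds \<subseteq> carrier_vec n"
      "gram n (cs @ ds) = S" and d0: "\<forall>d\<in>set ds. H *\<^sub>v d = 0\<^sub>v m"
    using gram_rank_reduction[OF H xs(2)] xs vec_space.rank_le_nc[OF H] by auto
  have HC: "set (?M xs) \<subseteq> carrier_vec m" if "set xs \<subseteq> carrier_vec n" for xs
    using that H by auto
  have "gram m (?M ds) = 0\<^sub>m m m"
    using d0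
  proof (induction ds)
    case (Cons d ds)
    have "gram m [0\<^sub>v m] = 0\<^sub>m m m" by (intro eq_matI) (auto simp: gram_def)
    then show ?case using Cons by (simp add: gram_Cons[of m _ "?M ds"])
  qed simp
  then have "H * S * mat_adjoint H = gram m (?M cs)"
    using gram_map_mult[OF H, of "cs @ ds"] cd by (simp add: gram_append)
  then have rate': "I \<le> ln (gain m C (?M cs))"
    using rate ln_cmod_det_eq_ln_gain[OF C HC[OF cd(2)]] by simp
  \<comment> \<open>Rank 0 would leave \<open>cs\<close> empty, with gain 1 and hence rate
    0.\<close>
  then have r0: "0 < ?r" using I cd(1) by (cases cs) auto
  \<comment> \<open>The geometric mean of the factors.\<close>
  define \<mu> where "\<mu> = exp (ln (gain m C (?M cs)) / real ?r)"
  have mu: "0 < \<mu>" by (simp add: \<mu>_def)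
  have "\<mu> ^ ?r = exp (real ?r * (ln (gain m C (?M cs)) / real ?r))"
    unfolding \<mu>_def by (rule exp_of_nat_mult[symmetric])
  also have "\<dots> = gain m C (?M cs)"
    using r0 gain_pos[OF C HC[OF cd(2)]] by simp
  finally have gain: "gain m C (?M cs) = \<mu> ^ length cs" using cd(1) by simp
  obtain bs where bs: "length bs = length cs" "set bs \<subseteq> carrier_vec n" "gram n bs = gram n cs"
    and eqs: "\<And>i. i < length cs \<Longrightarrow> 1 + iform (C + gram m (?M (drop (Suc i) bs))) (H *\<^sub>v bs ! i) = \<mu>"
    using equalize_gain[OF H mu C cd(2) gain] by blast
  have mu_ge: "exp (I / real ?r) \<le> \<mu>"
    using rate' r0 by (simp add: \<mu>_def divide_right_mono)
  \<comment> \<open>Makes every SINR \<open>\<mu> - 1\<close> positive, so no received vector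
    vanishes and each has an optimal receiver.\<close>
  have gt1: "1 < exp (I / real ?r)" using I r0 by simp
  have "bs ! i \<noteq> 0\<^sub>v n \<and> (\<exists>r. r \<in> carrier_vec m \<and> cvnorm r = 1 \<and>
      (exp (I / real ?r) - 1) * qform (C + gram m (?M (drop (Suc i) bs))) r
        \<le> (cmod (cinner r (H *\<^sub>v bs ! i)))\<^sup>2)" if i: "i < ?r" for i
  proof -
    let ?D = "C + gram m (?M (drop (Suc i) bs))"
    have bi: "bs ! i \<in> carrier_vec n" using i bs(1,2) cd(1) by (metis nth_mem subsetD)
    have dr: "set (drop (Suc i) bs) \<subseteq> carrier_vec n" using bs(2) set_drop_subset by fast
    have D: "pd_mat m ?D" by (rule pd_add_gram[OF C HC[OF dr]])
    have g: "H *\<^sub>v bs ! i \<in> carrier_vec m" using H bi by simp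
    have pos: "0 < iform ?D (H *\<^sub>v bs ! i)" using eqs[of i] i mu_ge gt1 unfolding cd(1) by linarith
    have ne: "H *\<^sub>v bs ! i \<noteq> 0\<^sub>v m"
    proof
      assume "H *\<^sub>v bs ! i = 0\<^sub>v m"
      then have "iform ?D (H *\<^sub>v bs ! i) = 0" by (simp add: iform_def qform_def cinner_def)
      then show False using pos by simp
    qed
    then have nz: "bs ! i \<noteq> 0\<^sub>v n" using H by (auto simp: scalar_prod_def intro!: eq_vecI)
    obtain r where r: "r \<in> carrier_vec m" "cvnorm r = 1"
        "(cmod (cinner r (H *\<^sub>v bs ! i)))\<^sup>2 = iform ?D (H *\<^sub>v bs ! i) * qform ?D r"
      using mmse_receiver[OF D g ne] by blast
    have "0 \<le> qform ?D r" using pd_imp_psd[OF D] r(1) by (simp add: psd_mat_iff)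
    moreover have "exp (I / real ?r) - 1 \<le> iform ?D (H *\<^sub>v bs ! i)"
      using eqs[of i] i cd(1) mu_ge by simp
    ultimately have "(exp (I / real ?r) - 1) * qform ?D r \<le> (cmod (cinner r (H *\<^sub>v bs ! i)))\<^sup>2"
      unfolding r(3) by (rule mult_right_mono[rotated])
    then show ?thesis using nz r by blast
  qed
  then obtain rs where "\<forall>i<?r. bs ! i \<noteq> 0\<^sub>v n \<and> rs i \<in> carrier_vec m \<and> cvnorm (rs i) = 1 \<and>
      (exp (I / real ?r) - 1) * qform (C + gram m (?M (drop (Suc i) bs))) (rs i)
        \<le> (cmod (cinner (rs i) (H *\<^sub>v bs ! i)))\<^sup>2" by metis
  moreover have "gram n (bs @ ds) = S" using cd(4) bs(3) by (simp add: gram_append)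
  ultimately show ?thesis using bs(1,2) cd(1,3) by metis
qed

section \<open>Strategies and their covariances\<close>

lemma gain_ge_powerI:
  assumes C: "pd_mat n C" and mu: "0 \<le> \<mu>" and "set gs \<subseteq> carrier_vec n"
    and "\<And>i. i < length gs \<Longrightarrow> \<mu> \<le> 1 + iform (C + gram n (drop (Suc i) gs)) (gs ! i)"
  shows "\<mu> ^ length gs \<le> gain n C gs"
  using assms(3,4)
proof (induction gs)
  case (Cons g gs)
  have "\<mu> \<le> 1 + iform (C + gram n gs) g" using Cons.prems(2)[of 0] by simp
  moreover have "\<mu> ^ length gs \<le> gain n C gs"
  proof (rule Cons.IH)
    fix i assume "i < length gs"
    then show "\<mu> \<le> 1 + iform (C + gram n (drop (Suc i) gs)) (gs ! i)"
      using Cons.prems(2)[of "Suc i"] by simp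
  qed (use Cons.prems in simp)
  ultimately show ?case using mu by (simp add: mult_mono)
qed simp

lemma psd_gram: "set xs \<subseteq> carrier_vec n \<Longrightarrow> psd_mat n (gram n xs)"
  by (simp add: psd_mat_iff hermitian_gram qform_gram_nonneg)

text \<open>A receiver \<open>v\<close> sees the transmitter through \<open>H^H v\<close>. With
  \<open>S\<close> written as a Gram matrix, both claims become statements about lists.\<close>

lemma psd_congruence:
  assumes H: "H \<in> carrier_mat m n" and S: "psd_mat n S"
  shows "hermitian_mat m (H * S * mat_adjoint H)"
    and "v \<in> carrier_vec m \<Longrightarrow> qform (H * S * mat_adjoint H) v = qform S (mat_adjoint H *\<^sub>v v)"
proof -
  obtain xs where xs: "set xs \<subseteq> carrier_vec n" "gram n xs = S"
    using psd_factorization[OF S] .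
  have eq: "H * S * mat_adjoint H = gram m (map ((*\<^sub>v) H) xs)"
    using gram_map_mult[OF H xs(1)] xs(2) by simp
  show "hermitian_mat m (H * S * mat_adjoint H)" unfolding eq by (rule hermitian_gram)
  assume v: "v \<in> carrier_vec m"
  have a: "mat_adjoint H *\<^sub>v v \<in> carrier_vec n" by (rule mult_mat_vec_carrier[OF mat_adjoint_carrier[OF H] v])
  have "qform (gram m (map ((*\<^sub>v) H) xs)) v = (\<Sum>x\<leftarrow>xs. (cmod (cinner v (H *\<^sub>v x)))\<^sup>2)"
    using xs(1) H v by (subst qform_gram) (auto simp: o_def)
  also have "\<dots> = (\<Sum>x\<leftarrow>xs. (cmod (cinner (mat_adjoint H *\<^sub>v v) x))\<^sup>2)"
    using xs(1) by (intro arg_cong[where f = sum_list] map_cong) (auto simp: cinner_adjoint[OF H v])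
  also have "\<dots> = qform S (mat_adjoint H *\<^sub>v v)"
    unfolding xs(2)[symmetric] using xs(1) a by (simp add: qform_gram)
  finally show "qform (H * S * mat_adjoint H) v = qform S (mat_adjoint H *\<^sub>v v)" unfolding eq .
qed

section \<open>Interference covariances\<close>

lemma qform_one: "v \<in> carrier_vec n \<Longrightarrow> qform (1\<^sub>m n) v = Re (cinner v v)"
  by (simp add: qform_def)

lemma hermitian_one: "hermitian_mat n (1\<^sub>m n)"
  by (auto simp: hermitian_mat_def intro!: eq_matI)

text \<open>Splits the interference after a receiver \<open>v\<close> by links, which makes its
  monotonicity in the covariances visible. The receiving link \<open>l\<close> stays fixed while
  induction on \<open>L\<close> adds one transmitter at a time.\<close>

lemma Omega_hermitian_qform:
  assumes "\<And>k. k < L \<Longrightarrow> H l k \<in> carrier_mat (NR l) (NT k)"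
    and "\<And>k. k < L \<Longrightarrow> psd_mat (NT k) (S k)"
  shows "hermitian_mat (NR l) (Omega L NR H Phi S l) \<and>
    (\<forall>v\<in>carrier_vec (NR l). qform (Omega L NR H Phi S l) v =
      Re (cinner v v) + (\<Sum>k<L. if Phi l k then qform (S k) (mat_adjoint (H l k) *\<^sub>v v) else 0))"
  using assms
proof (induction L)
  case 0
  have "Omega 0 NR H Phi S l = 1\<^sub>m (NR l)" by (auto simp: Omega_def)
  then show ?case by (simp add: hermitian_one qform_one)
next
  case (Suc L)
  let ?X = "H l L * S L * mat_adjoint (H l L)"
  have H: "H l L \<in> carrier_mat (NR l) (NT L)" and S: "psd_mat (NT L) (S L)" using Suc.prems by auto
  note X = psd_congruence[OF H S]
  have Xc: "?X \<in> carrier_mat (NR l) (NR l)" using X(1) by (simp add: hermitian_mat_def)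
  have Oc: "Omega L NR H Phi S l \<in> carrier_mat (NR l) (NR l)" for L by (simp add: Omega_def)
  have IH: "hermitian_mat (NR l) (Omega L NR H Phi S l)"
    "\<And>v. v \<in> carrier_vec (NR l) \<Longrightarrow> qform (Omega L NR H Phi S l) v =
      Re (cinner v v) + (\<Sum>k<L. if Phi l k then qform (S k) (mat_adjoint (H l k) *\<^sub>v v) else 0)"
    using Suc by auto
  show ?case
  proof (cases "Phi l L")
    case True
    have "Omega (Suc L) NR H Phi S l = Omega L NR H Phi S l + ?X"
      using Xc True by (intro eq_matI) (auto simp: Omega_def add.assoc)
    then show ?thesis
      using IH X Xc Oc True by (auto simp: hermitian_add qform_add[of _ "NR l"])
  next
    case False
    then have "Omega (Suc L) NR H Phi S l = Omega L NR H Phi S l" by (simp add: Omega_def)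
    then show ?thesis using IH False by simp
  qed
qed

lemma Omega_pd:
  assumes "\<And>k. k < L \<Longrightarrow> H l k \<in> carrier_mat (NR l) (NT k)"
    and "\<And>k. k < L \<Longrightarrow> psd_mat (NT k) (S k)"
  shows "pd_mat (NR l) (Omega L NR H Phi S l)"
proof -
  note * = Omega_hermitian_qform[where H = H and NR = NR and NT = NT and S = S and l = l and L = L and Phi = Phi,
      OF assms, simplified]
  have "0 < qform (Omega L NR H Phi S l) v" if v: "v \<in> carrier_vec (NR l)" "v \<noteq> 0\<^sub>v (NR l)" for v
  proof -
    have "0 < Re (cinner v v)"
      using cinner_self_eq_0[OF v(1)] v(2) cinner_self_Re_nonneg[of v] by fastforce
    moreover have "0 \<le> (\<Sum>k<L. if Phi l k then qform (S k) (mat_adjoint (H l k) *\<^sub>v v) else 0)"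
    proof (rule sum_nonneg)
      fix k assume "k \<in> {..<L}"
      then have "psd_mat (NT k) (S k)" "mat_adjoint (H l k) *\<^sub>v v \<in> carrier_vec (NT k)"
        using assms mult_mat_vec_carrier[OF mat_adjoint_carrier v(1)] by auto
      then show "0 \<le> (if Phi l k then qform (S k) (mat_adjoint (H l k) *\<^sub>v v) else 0)"
        by (simp add: psd_mat_iff)
    qed
    ultimately show ?thesis using * v(1) by simp
  qed
  then show ?thesis using * by (simp add: pd_mat_def)
qed

lemma rank_pos_if_rate_pos:
  assumes H: "H \<in> carrier_mat m n" and S: "S \<in> carrier_mat n n" and B: "B \<in> carrier_mat m m"
    and rate: "0 < ln (cmod (det (1\<^sub>m m + H * S * mat_adjoint H * B)))"
  shows "0 < vec_space.rank m H"
proof (rule ccontr)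
  assume "\<not> ?thesis"
  then have "H = 0\<^sub>m m n" using rank_factorization[OF H] H by (auto intro!: eq_matI)
  then have "H * S * mat_adjoint H = 0\<^sub>m m m" using S by auto
  then have "1\<^sub>m m + H * S * mat_adjoint H * B = 1\<^sub>m m" using B by simp
  then show False using rate by simp
qed

lemma mtrace_gram:
  assumes "set xs \<subseteq> carrier_vec n"
  shows "Re (mtrace (gram n xs)) = (\<Sum>x\<leftarrow>xs. Re (cinner x x))"
  using assms
proof (induction xs)
  case Nil
  then show ?case by (simp add: mtrace_def)
next
  case (Cons x xs)
  have "Re (mtrace (gram n (x # xs))) = Re (mtrace (gram n [x])) + Re (mtrace (gram n xs))"
    unfolding gram_Cons[of n x xs] by (simp add: mtrace_def sum.distrib)
  moreover have "mtrace (gram n [x]) = cinner x x"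
    using Cons.prems by (auto simp: mtrace_def gram_def cinner_def mult.commute)
  ultimately show ?case using Cons by simp
qed

section \<open>Strategies as lists of transmit vectors scaled by amplitude\<close>

definition stream_vecs ::
  "(nat \<Rightarrow> nat) \<Rightarrow> (nat \<Rightarrow> nat \<Rightarrow> complex vec) \<Rightarrow> (nat \<Rightarrow> nat \<Rightarrow> real) \<Rightarrow> nat \<Rightarrow> complex vec list" where
  "stream_vecs M T p k = map (\<lambda>n. of_real (sqrt (p k n)) \<cdot>\<^sub>v T k n) [0..<M k]"

lemma length_stream_vecs [simp]: "length (stream_vecs M T p k) = M k"
  by (simp add: stream_vecs_def)

lemma sum_list_map_upt: "(\<Sum>n\<leftarrow>[a..<b]. f n) = (\<Sum>n\<in>{a..<b}. f n :: 'a :: comm_monoid_add)"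
  by (simp add: interv_sum_list_conv_sum_set_nat)

context
  fixes L :: nat and NT NR M :: "nat \<Rightarrow> nat" and T R :: "nat \<Rightarrow> nat \<Rightarrow> complex vec"
    and p :: "nat \<Rightarrow> nat \<Rightarrow> real"
  assumes valid: "valid_strategy L NT NR M T R p"
begin

lemma stream_vecs_carrier: "k < L \<Longrightarrow> set (stream_vecs M T p k) \<subseteq> carrier_vec (NT k)"
  using valid by (auto simp: valid_strategy_def stream_vecs_def)

lemma cov_of_eq_gram:
  assumes k: "k < L"
  shows "cov_of NT M T p k = gram (NT k) (stream_vecs M T p k)"
proof (rule eq_matI)
  fix i j assume "i < dim_row (gram (NT k) (stream_vecs M T p k))"
    "j < dim_col (gram (NT k) (stream_vecs M T p k))"
  then have ij: "i < NT k" "j < NT k" by auto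
  have "gram (NT k) (stream_vecs M T p k) $$ (i, j) =
      (\<Sum>n<M k. (of_real (sqrt (p k n)) \<cdot>\<^sub>v T k n) $ i * cnj ((of_real (sqrt (p k n)) \<cdot>\<^sub>v T k n) $ j))"
    using ij by (simp add: gram_def stream_vecs_def o_def sum_list_map_upt lessThan_atLeast0 del: index_smult_vec)
  also have "\<dots> = (\<Sum>n<M k. complex_of_real (p k n) * T k n $ i * cnj (T k n $ j))"
  proof (rule sum.cong)
    fix n assume "n \<in> {..<M k}"
    then have n: "T k n \<in> carrier_vec (NT k)" "0 \<le> p k n"
      using valid k by (auto simp: valid_strategy_def)
    then have "complex_of_real (p k n) = of_real (sqrt (p k n)) * of_real (sqrt (p k n))"
      by (simp flip: of_real_mult)
    then show "(of_real (sqrt (p k n)) \<cdot>\<^sub>v T k n) $ i * cnj ((of_real (sqrt (p k n)) \<cdot>\<^sub>v T k n) $ j)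
      = complex_of_real (p k n) * T k n $ i * cnj (T k n $ j)"
      using n(1) ij by (simp add: mult_ac)
  qed simp
  finally show "cov_of NT M T p k $$ (i, j) = gram (NT k) (stream_vecs M T p k) $$ (i, j)"
    using ij by (simp add: cov_of_def)
qed (simp_all add: cov_of_def)

lemma cov_of_psd: "k < L \<Longrightarrow> psd_mat (NT k) (cov_of NT M T p k)"
  using stream_vecs_carrier by (simp add: cov_of_eq_gram psd_gram)

lemma trace_cov_of:
  assumes k: "k < L"
  shows "Re (mtrace (cov_of NT M T p k)) = (\<Sum>n<M k. \<bar>p k n\<bar>)"
proof -
  have "Re (mtrace (cov_of NT M T p k)) =
      (\<Sum>n<M k. Re (cinner (of_real (sqrt (p k n)) \<cdot>\<^sub>v T k n) (of_real (sqrt (p k n)) \<cdot>\<^sub>v T k n)))"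
    unfolding cov_of_eq_gram[OF k] mtrace_gram[OF stream_vecs_carrier[OF k]]
    by (simp add: stream_vecs_def o_def sum_list_map_upt lessThan_atLeast0)
  also have "\<dots> = (\<Sum>n<M k. \<bar>p k n\<bar>)"
  proof (rule sum.cong)
    fix n assume "n \<in> {..<M k}"
    then have n: "T k n \<in> carrier_vec (NT k)" "0 \<le> p k n" "cvnorm (T k n) = 1"
      using valid k by (auto simp: valid_strategy_def)
    have "cinner (of_real (sqrt (p k n)) \<cdot>\<^sub>v T k n) (of_real (sqrt (p k n)) \<cdot>\<^sub>v T k n)
        = of_real (sqrt (p k n) * sqrt (p k n)) * cinner (T k n) (T k n)"
      using n(1) by (simp add: cinner_smult_left cinner_smult_right[of _ "NT k"] del: real_sqrt_mult_self)
    also have "cinner (T k n) (T k n) = 1"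
      using n(3) by (simp add: cvnorm_eq_1_iff cinner_self)
    finally show "Re (cinner (of_real (sqrt (p k n)) \<cdot>\<^sub>v T k n) (of_real (sqrt (p k n)) \<cdot>\<^sub>v T k n)) = \<bar>p k n\<bar>"
      using n(2) by simp
  qed simp
  finally show ?thesis .
qed

lemma SPMP_obj_cov_of: "SPMP_obj L (cov_of NT M T p) = ESPMP_obj L M p"
  by (simp add: SPMP_obj_def ESPMP_obj_def trace_cov_of)

lemma cmod_cinner_stream:
  assumes "k < L" "n < M k" "H \<in> carrier_mat m (NT k)" "r \<in> carrier_vec m"
  shows "(cmod (cinner r (H *\<^sub>v (of_real (sqrt (p k n)) \<cdot>\<^sub>v T k n))))\<^sup>2
    = p k n * (cmod (cinner r (H *\<^sub>v T k n)))\<^sup>2"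
proof -
  have n: "T k n \<in> carrier_vec (NT k)" "0 \<le> p k n"
    using valid assms by (auto simp: valid_strategy_def)
  have "H *\<^sub>v (of_real (sqrt (p k n)) \<cdot>\<^sub>v T k n) = of_real (sqrt (p k n)) \<cdot>\<^sub>v (H *\<^sub>v T k n)"
    using assms(3) n(1) by (simp add: mult_mat_vec[of _ m "NT k"])
  moreover have "cinner r (of_real (sqrt (p k n)) \<cdot>\<^sub>v (H *\<^sub>v T k n)) = of_real (sqrt (p k n)) * cinner r (H *\<^sub>v T k n)"
    using assms(3,4) n(1) by (intro cinner_smult_right[of _ m]) auto
  ultimately show ?thesis using n(2) by (simp add: norm_mult power_mult_distrib)
qed

text \<open>Turns the SINR denominator into the quadratic form of a noise covariance at the receive
  vector; the 1 is the identity noise seen by a unit-norm receiver.\<close>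

lemma interference_eq_qform:
  assumes H_dim: "\<And>k. k < L \<Longrightarrow> H l k \<in> carrier_mat (NR l) (NT k)"
    and Phi_diag: "\<not> Phi l l" and l: "l < L" and m: "m < M l"
  shows "1 + (\<Sum>k<L. \<Sum>n<M k. p k n * Psi H Phi T R l m k n) =
    qform (Omega L NR H Phi (cov_of NT M T p) l +
      gram (NR l) (map ((*\<^sub>v) (H l l)) (drop (Suc m) (stream_vecs M T p l)))) (R l m)"
proof -
  let ?r = "R l m"
  define A where "A = gram (NR l) (map ((*\<^sub>v) (H l l)) (drop (Suc m) (stream_vecs M T p l)))"
  define f where "f k = (if Phi l k then qform (cov_of NT M T p k) (mat_adjoint (H l k) *\<^sub>v ?r) else 0)" for k
  have r: "?r \<in> carrier_vec (NR l)" "cvnorm ?r = 1"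
    using valid l m by (auto simp: valid_strategy_def)
  note Om = Omega_hermitian_qform[where H = H and NR = NR and NT = NT and S = "cov_of NT M T p"
      and l = l and L = L and Phi = Phi, OF H_dim cov_of_psd, simplified]
  have qO: "qform (Omega L NR H Phi (cov_of NT M T p) l) ?r = 1 + (\<Sum>k<L. f k)"
    using Om r by (simp add: f_def cvnorm_eq_1_iff)
  have Hll: "H l l \<in> carrier_mat (NR l) (NT l)" using H_dim l by simp
  have "set (drop (Suc m) (stream_vecs M T p l)) \<subseteq> carrier_vec (NT l)"
    using stream_vecs_carrier[OF l] set_drop_subset by fast
  then have dc: "set (map ((*\<^sub>v) (H l l)) (drop (Suc m) (stream_vecs M T p l))) \<subseteq> carrier_vec (NR l)"
    using Hll by auto
  have qA: "qform A ?r = (\<Sum>n\<in>{Suc m..<M l}. p l n * (cmod (cinner ?r (H l l *\<^sub>v T l n)))\<^sup>2)"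
  proof -
    have "qform A ?r = (\<Sum>n\<in>{Suc m..<M l}. (cmod (cinner ?r (H l l *\<^sub>v (of_real (sqrt (p l n)) \<cdot>\<^sub>v T l n))))\<^sup>2)"
      unfolding A_def qform_gram[OF dc r(1)]
      by (simp add: stream_vecs_def drop_map o_def sum_list_map_upt)
    also have "\<dots> = (\<Sum>n\<in>{Suc m..<M l}. p l n * (cmod (cinner ?r (H l l *\<^sub>v T l n)))\<^sup>2)"
      by (intro sum.cong) (auto simp: cmod_cinner_stream[OF l _ Hll r(1)])
    finally show ?thesis .
  qed
  \<comment> \<open>On the own link \<open>Psi\<close> vanishes for \<open>n \<le> m\<close>, which
    leaves the streams from \<open>Suc m\<close> on; \<open>Omega\<close> has no own term because
    \<open>Phi l l\<close> is false. All other links enter through \<open>Omega\<close>.\<close>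
  have link_sum: "(\<Sum>n<M k. p k n * Psi H Phi T R l m k n) = f k + (if k = l then qform A ?r else 0)"
    if k: "k < L" for k
  proof (cases "k = l")
    case True
    have "(\<Sum>n<M l. p l n * Psi H Phi T R l m l n) =
        (\<Sum>n\<in>{Suc m..<M l}. p l n * (cmod (cinner ?r (H l l *\<^sub>v T l n)))\<^sup>2)"
      by (rule sum.mono_neutral_cong_right) (auto simp: Psi_def)
    then show ?thesis using True Phi_diag qA by (simp add: f_def)
  next
    case False
    show ?thesis
    proof (cases "Phi l k")
      case True
      have Hk: "H l k \<in> carrier_mat (NR l) (NT k)" by (rule H_dim[OF k])
      have a: "mat_adjoint (H l k) *\<^sub>v ?r \<in> carrier_vec (NT k)"
        by (rule mult_mat_vec_carrier[OF mat_adjoint_carrier[OF Hk] r(1)])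
      have "f k = (\<Sum>n<M k. (cmod (cinner (mat_adjoint (H l k) *\<^sub>v ?r) (of_real (sqrt (p k n)) \<cdot>\<^sub>v T k n)))\<^sup>2)"
        using True unfolding f_def cov_of_eq_gram[OF k] qform_gram[OF stream_vecs_carrier[OF k] a]
        by (simp add: stream_vecs_def o_def sum_list_map_upt lessThan_atLeast0)
      also have "\<dots> = (\<Sum>n<M k. p k n * Psi H Phi T R l m k n)"
      proof (rule sum.cong)
        fix n assume n: "n \<in> {..<M k}"
        then have tc: "of_real (sqrt (p k n)) \<cdot>\<^sub>v T k n \<in> carrier_vec (NT k)"
          using valid k by (auto simp: valid_strategy_def)
        show "(cmod (cinner (mat_adjoint (H l k) *\<^sub>v ?r) (of_real (sqrt (p k n)) \<cdot>\<^sub>v T k n)))\<^sup>2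
          = p k n * Psi H Phi T R l m k n"
          using cmod_cinner_stream[OF k _ Hk r(1), of n] n True False
          unfolding cinner_adjoint[OF Hk r(1) tc, symmetric] by (simp add: Psi_def)
      qed simp
      finally show ?thesis using False by simp
    next
      case F: False
      then show ?thesis using False by (simp add: f_def Psi_def)
    qed
  qed
  have "1 + (\<Sum>k<L. \<Sum>n<M k. p k n * Psi H Phi T R l m k n) =
      1 + (\<Sum>k<L. f k + (if k = l then qform A ?r else 0))"
    by (simp add: link_sum)
  also have "\<dots> = 1 + (\<Sum>k<L. f k) + qform A ?r"
    using l by (simp add: sum.distrib)
  also have "\<dots> = qform (Omega L NR H Phi (cov_of NT M T p) l + A) ?r"
    unfolding qO[symmetric] using Om r(1) by (simp add: qform_add[of _ "NR l"] hermitian_mat_def A_def)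
  finally show ?thesis unfolding A_def .
qed

lemma SINR_eq:
  assumes H_dim: "\<And>k. k < L \<Longrightarrow> H l k \<in> carrier_mat (NR l) (NT k)"
    and Phi_diag: "\<not> Phi l l" and l: "l < L" and m: "m < M l"
  shows "SINR L M H Phi T R p l m =
    (cmod (cinner (R l m) (H l l *\<^sub>v stream_vecs M T p l ! m)))\<^sup>2 /
    qform (Omega L NR H Phi (cov_of NT M T p) l +
      gram (NR l) (map ((*\<^sub>v) (H l l)) (drop (Suc m) (stream_vecs M T p l)))) (R l m)"
proof -
  have r: "R l m \<in> carrier_vec (NR l)" using valid l m by (auto simp: valid_strategy_def)
  have den: "1 + (\<Sum>k<L. \<Sum>n<M k. p k n * Psi H Phi T R l m k n) =
    qform (Omega L NR H Phi (cov_of NT M T p) l +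
      gram (NR l) (map ((*\<^sub>v) (H l l)) (drop (Suc m) (stream_vecs M T p l)))) (R l m)"
    by (rule interference_eq_qform) (use assms in auto)
  have num: "(cmod (cinner (R l m) (H l l *\<^sub>v stream_vecs M T p l ! m)))\<^sup>2
      = p l m * (cmod (cinner (R l m) (H l l *\<^sub>v T l m)))\<^sup>2"
    using cmod_cinner_stream[OF l m H_dim[OF l] r] m by (simp add: stream_vecs_def)
  show ?thesis unfolding SINR_def den num ..
qed

end

section \<open>Passing between covariances and strategies\<close>

context
  fixes L :: nat and NT NR :: "nat \<Rightarrow> nat" and H :: "nat \<Rightarrow> nat \<Rightarrow> complex mat"
    and Phi :: "nat \<Rightarrow> nat \<Rightarrow> bool" and I0 :: "nat \<Rightarrow> real"
  assumes H_dim: "\<And>l k. l < L \<Longrightarrow> k < L \<Longrightarrow> H l k \<in> carrier_mat (NR l) (NT k)"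
    and Phi_diag: "\<And>l. l < L \<Longrightarrow> \<not> Phi l l"
    and I0_pos: "\<And>l. l < L \<Longrightarrow> I0 l > 0"
begin

lemma Omega_props:
  assumes "l < L" "\<And>k. k < L \<Longrightarrow> psd_mat (NT k) (S k)"
  shows "pd_mat (NR l) (Omega L NR H Phi S l)"
    and "\<And>v. v \<in> carrier_vec (NR l) \<Longrightarrow> qform (Omega L NR H Phi S l) v =
      Re (cinner v v) + (\<Sum>k<L. if Phi l k then qform (S k) (mat_adjoint (H l k) *\<^sub>v v) else 0)"
  using Omega_pd[where H = H and NR = NR and NT = NT and S = S and l = l and L = L and Phi = Phi,
      OF H_dim[OF assms(1)] assms(2)]
    Omega_hermitian_qform[where H = H and NR = NR and NT = NT and S = S and l = l and L = L and Phi = Phi,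
      OF H_dim[OF assms(1)] assms(2)]
  by simp_all

text \<open>A link without streams would carry no SINR constraint, so no strategy could vouch for
  its rate. The positive rate of a feasible covariance rules this out.\<close>

lemma nstreams_pos:
  assumes S: "SPMP_feasible L NT NR H Phi I0 S" and l: "l < L"
  shows "0 < nstreams NR H l"
proof -
  have psd: "\<And>k. k < L \<Longrightarrow> psd_mat (NT k) (S k)" and rate: "I0 l \<le> rate L NR H Phi S l"
    using S l by (auto simp: SPMP_feasible_def)
  note C = Omega_props(1)[OF l psd]
  show ?thesis unfolding nstreams_def
  proof (rule rank_pos_if_rate_pos[OF H_dim[OF l l] _ pd_minv(1)[OF C]])
    show "S l \<in> carrier_mat (NT l) (NT l)" using psd[OF l] by (simp add: psd_mat_def)
    show "0 < ln (cmod (det (1\<^sub>m (NR l) + H l l * S l * mat_adjoint (H l l) *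
        minv (Omega L NR H Phi S l))))"
      using rate I0_pos[OF l] by (simp add: rate_def minv_def)
  qed
qed

lemma ESPMP_feasible_imp_SPMP_feasible:
  assumes feas: "ESPMP_feasible L NT NR H Phi I0 T R p"
    and pos: "\<And>l. l < L \<Longrightarrow> 0 < nstreams NR H l"
  shows "SPMP_feasible L NT NR H Phi I0 (cov_of NT (nstreams NR H) T p)"
proof -
  let ?N = "nstreams NR H"
  let ?S = "cov_of NT ?N T p"
  have valid: "valid_strategy L NT NR ?N T R p"
    and sinr: "\<And>l m. l < L \<Longrightarrow> m < ?N l \<Longrightarrow> gamma0 NR H I0 l \<le> SINR L ?N H Phi T R p l m"
    using feas by (auto simp: ESPMP_feasible_def)
  note psd = cov_of_psd[OF valid]
  have "I0 l \<le> rate L NR H Phi ?S l" if l: "l < L" for l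
  proof -
    let ?C = "Omega L NR H Phi ?S l"
    let ?b = "stream_vecs ?N T p l"
    let ?gs = "map ((*\<^sub>v) (H l l)) ?b"
    have C: "pd_mat (NR l) ?C" by (rule Omega_props(1)[OF l psd])
    have bc: "set ?b \<subseteq> carrier_vec (NT l)" by (rule stream_vecs_carrier[OF valid l])
    have Hl: "H l l \<in> carrier_mat (NR l) (NT l)" by (rule H_dim[OF l l])
    have gc: "set ?gs \<subseteq> carrier_vec (NR l)" using bc Hl by auto
    have "1 + gamma0 NR H I0 l \<le> 1 + iform (?C + gram (NR l) (drop (Suc m) ?gs)) (?gs ! m)"
      if m: "m < length ?gs" for m
    proof -
      let ?D = "?C + gram (NR l) (drop (Suc m) ?gs)"
      have m': "m < ?N l" using m by simp
      have r: "R l m \<in> carrier_vec (NR l)" "cvnorm (R l m) = 1"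
        using valid l m' by (auto simp: valid_strategy_def)
      then have r0: "R l m \<noteq> 0\<^sub>v (NR l)" by (auto simp: cvnorm_def)
      have "set (drop (Suc m) ?gs) \<subseteq> carrier_vec (NR l)" using gc set_drop_subset by fast
      then have D: "pd_mat (NR l) ?D" by (rule pd_add_gram[OF C])
      have g: "?gs ! m \<in> carrier_vec (NR l)" using gc m by (meson nth_mem subsetD)
      have q: "0 < qform ?D (R l m)" using D r(1) r0 by (simp add: pd_mat_def)
      have "gamma0 NR H I0 l \<le> (cmod (cinner (R l m) (?gs ! m)))\<^sup>2 / qform ?D (R l m)"
        using sinr[OF l m'] SINR_eq[OF valid, of H l Phi m] H_dim[OF l] Phi_diag[OF l] l m'
        by (simp add: drop_map)
      also have "\<dots> \<le> iform ?D (?gs ! m)"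
        using cinner_sq_le_qform_iform[OF D r(1) g] q by (simp add: divide_le_eq mult.commute)
      finally show ?thesis by simp
    qed
    then have "(1 + gamma0 NR H I0 l) ^ length ?gs \<le> gain (NR l) ?C ?gs"
      by (intro gain_ge_powerI[OF C _ gc]) (auto simp: gamma0_def)
    \<comment> \<open>The origin of \<open>gamma0\<close>: equal factors
      \<open>exp (I0 l / M)\<close>, one for each of the \<open>M\<close> streams, multiply to
      \<open>exp (I0 l)\<close>.\<close>
    moreover have "(1 + gamma0 NR H I0 l) ^ length ?gs = exp (real (?N l) * (I0 l / real (?N l)))"
      by (simp add: gamma0_def flip: exp_of_nat_mult)
    moreover have "\<dots> = exp (I0 l)" using pos[OF l] by simp
    ultimately have "exp (I0 l) \<le> gain (NR l) ?C ?gs" by simp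
    then have "I0 l \<le> ln (gain (NR l) ?C ?gs)"
      using gain_pos[OF C gc] by (simp add: ln_ge_iff)
    moreover have "H l l * ?S l * mat_adjoint (H l l) = gram (NR l) ?gs"
      unfolding cov_of_eq_gram[OF valid l] by (rule gram_map_mult[OF Hl bc])
    ultimately show ?thesis
      using ln_cmod_det_eq_ln_gain[OF C gc] by (simp add: rate_def minv_def)
  qed
  then show ?thesis using psd by (simp add: SPMP_feasible_def)
qed

text \<open>Each link is decomposed against the interference caused by the given \<open>S\<close>, not by its reduction:
  the interference of the reduced covariances is only lower, so all SINR constraints survive.\<close>

lemma SPMP_feasible_imp_ESPMP_feasible:
  assumes feas: "SPMP_feasible L NT NR H Phi I0 S"
  shows "\<exists>T R p. ESPMP_feasible L NT NR H Phi I0 T R p \<and>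
    ESPMP_obj L (nstreams NR H) p \<le> SPMP_obj L S \<and>
    (ESPMP_obj L (nstreams NR H) p = SPMP_obj L S \<longrightarrow>
      (\<forall>l<L. cov_of NT (nstreams NR H) T p l = S l))"
proof -
  let ?N = "nstreams NR H"
  let ?O = "Omega L NR H Phi S"
  have psd: "\<And>k. k < L \<Longrightarrow> psd_mat (NT k) (S k)"
    and rate: "\<And>l. l < L \<Longrightarrow> I0 l \<le> rate L NR H Phi S l"
    using feas by (auto simp: SPMP_feasible_def)
  define Q where "Q l b r d \<longleftrightarrow> length b = ?N l \<and> set b \<subseteq> carrier_vec (NT l) \<and>
      set d \<subseteq> carrier_vec (NT l) \<and> gram (NT l) (b @ d) = S l \<and>
      (\<forall>i<?N l. b ! i \<noteq> 0\<^sub>v (NT l) \<and> r i \<in> carrier_vec (NR l) \<and> cvnorm (r i) = 1 \<and>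
        gamma0 NR H I0 l * qform (?O l + gram (NR l) (map ((*\<^sub>v) (H l l)) (drop (Suc i) b))) (r i)
          \<le> (cmod (cinner (r i) (H l l *\<^sub>v b ! i)))\<^sup>2)" for l b d and r :: "nat \<Rightarrow> complex vec"
  have "\<exists>b r d. Q l b r d" if l: "l < L" for l
    using link_decomposition[OF H_dim[OF l l] psd[OF l] Omega_props(1)[OF l psd] I0_pos[OF l]] rate[OF l]
    unfolding Q_def nstreams_def gamma0_def rate_def minv_def by blast
  then obtain b r d where Q: "\<And>l. l < L \<Longrightarrow> Q l (b l) (r l) (d l)" by metis
  have len: "length (b l) = ?N l" and bc: "set (b l) \<subseteq> carrier_vec (NT l)"
    and dc: "set (d l) \<subseteq> carrier_vec (NT l)" and S_eq: "gram (NT l) (b l @ d l) = S l"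
    if "l < L" for l
    using Q[OF that] unfolding Q_def by blast+
  have b0: "b l ! i \<noteq> 0\<^sub>v (NT l)" and rc: "r l i \<in> carrier_vec (NR l)" and r1: "cvnorm (r l i) = 1"
    and sinr: "gamma0 NR H I0 l * qform (?O l + gram (NR l) (map ((*\<^sub>v) (H l l)) (drop (Suc i) (b l)))) (r l i)
          \<le> (cmod (cinner (r l i) (H l l *\<^sub>v b l ! i)))\<^sup>2"
    if "l < L" "i < ?N l" for l i
    using Q[OF that(1)] that(2) unfolding Q_def by blast+
  \<comment> \<open>Each vector is split into squared length and direction; \<open>streams\<close>
    below puts it together again.\<close>
  define p where "p = (\<lambda>l i. (cvnorm (b l ! i))\<^sup>2)"
  define T where "T = (\<lambda>l i. of_real (1 / cvnorm (b l ! i)) \<cdot>\<^sub>v b l ! i)"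
  have bi: "b l ! i \<in> carrier_vec (NT l)" if "l < L" "i < ?N l" for l i
    using bc[OF that(1)] len[OF that(1)] that(2) by (metis nth_mem subsetD)
  have norm_pos: "0 < cvnorm (b l ! i)" if "l < L" "i < ?N l" for l i
  proof -
    have "Re (cinner (b l ! i) (b l ! i)) \<noteq> 0"
      using cinner_self_eq_0[OF bi[OF that]] b0[OF that] by blast
    then have "(cvnorm (b l ! i))\<^sup>2 \<noteq> 0" by (simp add: cvnorm_sq)
    moreover have "0 \<le> cvnorm (b l ! i)" by (simp add: cvnorm_def sum_nonneg)
    ultimately show ?thesis by simp
  qed
  have valid: "valid_strategy L NT NR ?N T r p"
    unfolding valid_strategy_def
  proof (intro allI impI conjI)
    fix l m assume lm: "l < L" "m < ?N l"
    show "T l m \<in> carrier_vec (NT l)" using bi[OF lm] by (simp add: T_def)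
    have "cinner (T l m) (T l m) = of_real ((1 / cvnorm (b l ! m))\<^sup>2) * cinner (b l ! m) (b l ! m)"
      using bi[OF lm] unfolding T_def
      by (simp add: cinner_smult_left cinner_smult_right[of _ "NT l"] power2_eq_square)
    then have "Re (cinner (T l m) (T l m)) = (1 / cvnorm (b l ! m))\<^sup>2 * (cvnorm (b l ! m))\<^sup>2"
      unfolding cvnorm_sq[of "b l ! m"] by simp
    then show "cvnorm (T l m) = 1"
      using norm_pos[OF lm] by (simp add: cvnorm_eq_1_iff power_divide)
  qed (use rc r1 in \<open>auto simp: p_def\<close>)
  have streams: "stream_vecs ?N T p l = b l" if l: "l < L" for l
  proof (rule nth_equalityI)
    fix i assume "i < length (stream_vecs ?N T p l)"
    then have i: "i < ?N l" by simp
    have "complex_of_real (sqrt ((cvnorm (b l ! i))\<^sup>2)) * of_real (1 / cvnorm (b l ! i)) = 1"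
      using norm_pos[OF l i] by simp
    then have "complex_of_real (sqrt (p l i)) \<cdot>\<^sub>v T l i = 1 \<cdot>\<^sub>v b l ! i"
      unfolding p_def T_def smult_smult_assoc by (simp only:)
    then show "stream_vecs ?N T p l ! i = b l ! i"
      using i by (simp add: stream_vecs_def)
  qed (simp add: len[OF l])
  let ?S = "cov_of NT ?N T p"
  have cov: "?S l = gram (NT l) (b l)" if "l < L" for l
    using cov_of_eq_gram[OF valid that] streams[OF that] by simp
  have S_split: "S l = ?S l + gram (NT l) (d l)" if "l < L" for l
    using S_eq[OF that] cov[OF that] by (simp add: gram_append)
  note psd' = cov_of_psd[OF valid]
  have le_S: "qform (?S k) v \<le> qform (S k) v" if "k < L" "v \<in> carrier_vec (NT k)" for k v
    unfolding S_split[OF that(1)] cov[OF that(1)] using that dc[OF that(1)]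
    by (simp add: qform_add[of _ "NT k"] qform_gram_nonneg)
  have le_O: "qform (Omega L NR H Phi ?S l) v \<le> qform (?O l) v"
    if l: "l < L" and v: "v \<in> carrier_vec (NR l)" for l v
  proof -
    have "(if Phi l k then qform (?S k) (mat_adjoint (H l k) *\<^sub>v v) else 0)
        \<le> (if Phi l k then qform (S k) (mat_adjoint (H l k) *\<^sub>v v) else 0)" if "k < L" for k
      using le_S[OF that mult_mat_vec_carrier[OF mat_adjoint_carrier[OF H_dim[OF l that]] v]] by simp
    then have "(\<Sum>k<L. if Phi l k then qform (?S k) (mat_adjoint (H l k) *\<^sub>v v) else 0)
        \<le> (\<Sum>k<L. if Phi l k then qform (S k) (mat_adjoint (H l k) *\<^sub>v v) else 0)"
      by (intro sum_mono) (metis lessThan_iff)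
    moreover note Omega_props(2)[where S = S, OF l psd v] Omega_props(2)[where S = ?S, OF l psd' v]
    ultimately show ?thesis by linarith
  qed
  have "gamma0 NR H I0 l \<le> SINR L ?N H Phi T r p l m" if l: "l < L" and m: "m < ?N l" for l m
  proof -
    let ?G = "gram (NR l) (map ((*\<^sub>v) (H l l)) (drop (Suc m) (b l)))"
    let ?D = "Omega L NR H Phi ?S l + ?G"
    have Hl: "H l l \<in> carrier_mat (NR l) (NT l)" by (rule H_dim[OF l l])
    have "set (drop (Suc m) (b l)) \<subseteq> carrier_vec (NT l)" using bc[OF l] set_drop_subset by fast
    then have gc: "set (map ((*\<^sub>v) (H l l)) (drop (Suc m) (b l))) \<subseteq> carrier_vec (NR l)"
      using Hl by auto
    note C' = Omega_props(1)[OF l psd'] and C = Omega_props(1)[OF l psd]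
    have r0: "r l m \<noteq> 0\<^sub>v (NR l)" using r1[OF l m] by (auto simp: cvnorm_def)
    have q: "0 < qform ?D (r l m)"
      using pd_add_gram[OF C' gc] rc[OF l m] r0 by (simp add: pd_mat_def)
    have "qform ?D (r l m) \<le> qform (?O l + ?G) (r l m)"
      using le_O[OF l rc[OF l m]] pd_mat_carrier[OF C] pd_mat_carrier[OF C'] rc[OF l m]
      by (simp add: qform_add[of _ "NR l"])
    moreover have "0 \<le> gamma0 NR H I0 l" using I0_pos[OF l] by (simp add: gamma0_def)
    ultimately have "gamma0 NR H I0 l * qform ?D (r l m)
        \<le> gamma0 NR H I0 l * qform (?O l + ?G) (r l m)"
      by (rule mult_left_mono)
    also note sinr[OF l m]
    finally have "gamma0 NR H I0 l \<le> (cmod (cinner (r l m) (H l l *\<^sub>v b l ! m)))\<^sup>2 / qform ?D (r l m)"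
      using q by (simp add: le_divide_eq)
    then show ?thesis
      using SINR_eq[OF valid, of H l Phi m] H_dim[OF l] Phi_diag[OF l] l m streams[OF l] by simp
  qed
  then have feas': "ESPMP_feasible L NT NR H Phi I0 T r p"
    using valid by (simp add: ESPMP_feasible_def)
  have tr: "Re (mtrace (S l)) = Re (mtrace (?S l)) + (\<Sum>x\<leftarrow>d l. Re (cinner x x))" if l: "l < L" for l
    unfolding S_eq[OF l, symmetric] cov[OF l]
    using bc[OF l] dc[OF l] by (simp add: mtrace_gram)
  have nn: "0 \<le> (\<Sum>x\<leftarrow>d l. Re (cinner x x))" for l
    by (intro sum_list_nonneg) (auto simp: cinner_self_Re_nonneg)
  \<comment> \<open>The objectives differ by the power of the dropped vectors, so equality forces
    all of them to be zero.\<close>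
  have obj: "SPMP_obj L S = ESPMP_obj L ?N p + (\<Sum>l<L. \<Sum>x\<leftarrow>d l. Re (cinner x x))"
    unfolding SPMP_obj_cov_of[OF valid, symmetric] SPMP_obj_def
    by (simp add: tr sum.distrib)
  have "?S l = S l" if eq: "ESPMP_obj L ?N p = SPMP_obj L S" and l: "l < L" for l
  proof -
    have "(\<Sum>l<L. \<Sum>x\<leftarrow>d l. Re (cinner x x)) = 0" using eq obj by simp
    then have z: "(\<Sum>x\<leftarrow>d l. Re (cinner x x)) = 0"
      using l nn by (subst (asm) sum_nonneg_eq_0_iff) auto
    have zero: "x = 0\<^sub>v (NT l)" if "x \<in> set (d l)" for x
      using z dc[OF l] that
      by (subst (asm) sum_list_nonneg_eq_0_iff) (auto simp: cinner_self_Re_nonneg intro: cinner_self_eq_0)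
    have "gram (NT l) (d l) = 0\<^sub>m (NT l) (NT l)"
    proof (rule eq_matI)
      fix i j assume "i < dim_row (0\<^sub>m (NT l) (NT l) :: complex mat)"
        "j < dim_col (0\<^sub>m (NT l) (NT l) :: complex mat)"
      then have ij: "i < NT l" "j < NT l" by auto
      have "map (\<lambda>x. x $ i * cnj (x $ j)) (d l) = map (\<lambda>_. 0) (d l)"
        by (rule map_cong) (use ij in \<open>auto dest!: zero\<close>)
      then show "gram (NT l) (d l) $$ (i, j) = 0\<^sub>m (NT l) (NT l) $$ (i, j)"
        using ij by (simp add: gram_def del: map_eq_conv)
    qed auto
    then show ?thesis using S_split[OF l] cov[OF l] by simp
  qed
  moreover have "ESPMP_obj L ?N p \<le> SPMP_obj L S"
    using obj nn by (simp add: sum_nonneg)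
  ultimately show ?thesis using feas' by blast
qed

end

theorem theorem7:
  fixes L :: nat and NT NR :: "nat \<Rightarrow> nat"
    and H :: "nat \<Rightarrow> nat \<Rightarrow> complex mat"
    and Phi :: "nat \<Rightarrow> nat \<Rightarrow> bool"
    and I0 :: "nat \<Rightarrow> real"
  assumes H_dim: "\<And>l k. l < L \<Longrightarrow> k < L \<Longrightarrow> H l k \<in> carrier_mat (NR l) (NT k)"
    and Phi_diag: "\<And>l. l < L \<Longrightarrow> \<not> Phi l l"
    and I0_pos: "\<And>l. l < L \<Longrightarrow> I0 l > 0"
    and SPMP_feas: "\<exists>S. SPMP_feasible L NT NR H Phi I0 S"
    and ESPMP_feas: "\<exists>T R p. ESPMP_feasible L NT NR H Phi I0 T R p"
  shows "(\<forall>T R p. ESPMP_optimal L NT NR H Phi I0 T R p \<longrightarrow>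
             SPMP_optimal L NT NR H Phi I0 (cov_of NT (nstreams NR H) T p))
       \<and> (\<forall>S. SPMP_optimal L NT NR H Phi I0 S \<longrightarrow>
             (\<exists>T R p. ESPMP_optimal L NT NR H Phi I0 T R p \<and>
                (\<forall>l<L. cov_of NT (nstreams NR H) T p l = S l)))"
proof -
  let ?N = "nstreams NR H"
  have pos: "0 < ?N l" if "l < L" for l
  proof -
    obtain S where "SPMP_feasible L NT NR H Phi I0 S" using SPMP_feas by blast
    then show ?thesis by (rule nstreams_pos[rotated 3]) (use assms(1-3) that in auto)
  qed
  have to_cov: "SPMP_feasible L NT NR H Phi I0 (cov_of NT ?N T p)"
    if "ESPMP_feasible L NT NR H Phi I0 T R p" for T R p
    by (rule ESPMP_feasible_imp_SPMP_feasible) (use assms(1-3) that pos in auto)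
  have obj: "SPMP_obj L (cov_of NT ?N T p) = ESPMP_obj L ?N p"
    if "ESPMP_feasible L NT NR H Phi I0 T R p" for T R p
    using that by (intro SPMP_obj_cov_of[of L NT NR ?N T R p]) (simp add: ESPMP_feasible_def)
  have to_strategy: "\<exists>T R p. ESPMP_feasible L NT NR H Phi I0 T R p \<and>
      ESPMP_obj L ?N p \<le> SPMP_obj L S \<and>
      (ESPMP_obj L ?N p = SPMP_obj L S \<longrightarrow> (\<forall>l<L. cov_of NT ?N T p l = S l))"
    if "SPMP_feasible L NT NR H Phi I0 S" for S
    by (rule SPMP_feasible_imp_ESPMP_feasible) (use assms(1-3) that in auto)
  show ?thesis
  proof (intro conjI allI impI)
    fix T R p assume opt: "ESPMP_optimal L NT NR H Phi I0 T R p"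
    show "SPMP_optimal L NT NR H Phi I0 (cov_of NT ?N T p)"
      unfolding SPMP_optimal_def
    proof (intro conjI allI impI)
      show "SPMP_feasible L NT NR H Phi I0 (cov_of NT ?N T p)"
        using opt to_cov by (auto simp: ESPMP_optimal_def)
      fix S' assume "SPMP_feasible L NT NR H Phi I0 S'"
      then obtain T' R' p' where "ESPMP_feasible L NT NR H Phi I0 T' R' p'"
        "ESPMP_obj L ?N p' \<le> SPMP_obj L S'" using to_strategy by blast
      then show "SPMP_obj L (cov_of NT ?N T p) \<le> SPMP_obj L S'"
        using opt obj[of T R p] unfolding ESPMP_optimal_def by (metis order_trans)
    qed
  next
    fix S assume opt: "SPMP_optimal L NT NR H Phi I0 S"
    then obtain T R p where f: "ESPMP_feasible L NT NR H Phi I0 T R p"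
      and le: "ESPMP_obj L ?N p \<le> SPMP_obj L S"
      and eqS: "ESPMP_obj L ?N p = SPMP_obj L S \<longrightarrow> (\<forall>l<L. cov_of NT ?N T p l = S l)"
      using to_strategy unfolding SPMP_optimal_def by blast
    \<comment> \<open>A strategy costs as much as its covariances, hence at least as much as
      \<open>S\<close>. The strategy built from \<open>S\<close> therefore has exactly the cost of
      \<open>S\<close>, and \<open>eqS\<close> returns \<open>S\<close> itself.\<close>
    have ge: "SPMP_obj L S \<le> ESPMP_obj L ?N p'"
      if "ESPMP_feasible L NT NR H Phi I0 T' R' p'" for T' R' p'
      using opt to_cov[OF that] obj[OF that] unfolding SPMP_optimal_def by metis
    have "ESPMP_optimal L NT NR H Phi I0 T R p"
      unfolding ESPMP_optimal_def using f le ge by (meson order_trans)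
    then show "\<exists>T R p. ESPMP_optimal L NT NR H Phi I0 T R p \<and>
        (\<forall>l<L. cov_of NT ?N T p l = S l)"
      using eqS le ge[OF f] by (metis order_antisym)
  qed
qed

end
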